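(* Assume (A1)–(A4) and $P^\star\in\Pi_{K^\star}\setminus\Pi_{K^\star-1}$ with $K^\star<\infty$. Suppose $\varphi(u-l)\in L^1(P^\star)$ and that the penalty satisfies, for every $K\ge 1$, $$\liminf_{n\to\infty}\frac{\mathrm{pen}(n,K+1)}{\mathrm{pen}(n,K)}>1\quad\text{and}\quad \limsup_{n\to\infty}\frac{(n\log\log n)^{1/2}}{\mathrm{pen}(n,K)}=0 .$$ (a) If, for every $K\ge1$, $P^\star\notin\Pi_K$ implies $H(P^\star|\Pi_{K+1})<H(P^\star|\Pi_K)$, and if $\mathcal G^a_{K^\star+1}$ is $P^\star$-Donsker, then $P^\star$-a.s. $\widehat K_n^L=K^\star$ for all $n$ large enough. (b) If $K^\star\le K_{\max}$ and $\mathcal G^a_{K_{\max}}$ is $P^\star$-Donsker, then $P^\star$-a.s. $\widehat K_n^G=K^\star$ for all $n$ large enough.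
   Context: Setting: $(\mathcal Z,\mathcal F)$ is a Polish space with its Borel $\sigma$-field and $\mu$ a $\sigma$-finite measure on it. $Z_1,Z_2,\dots$ are i.i.d. $\mathcal Z$-valued random variables with common law $P^\star\ll\mu$, density $p^\star$, $\ell^\star=\log p^\star$; $P^\star$ also denotes the law of the whole sequence. $\{(\Theta_K,d)\}_{K\ge1}$ is an increasing (nested) sequence of metric spaces, $\Theta_\infty=\bigcup_K\Theta_K$; for $\theta\in\Theta_\infty$, $P_\theta$ is a probability measure with density $p_\theta$ w.r.t. $\mu$ and $\ell_\theta=\log p_\theta$. $\Pi_K=\{P_\theta:\theta\in\Theta_K\}$, $\Pi_0=\emptyset$, $\Pi_\infty=\bigcup_K\Pi_K$. The order of $P^\star$ is $K^\star=\min\{K:P^\star\in\Pi_K\}$ ($=\infty$ if $P^\star\notin\Pi_\infty$). $\mathbb P_n=n^{-1}\sum_{i=1}^n\delta_{Z_i}$; $\lambda f=\int f\,d\lambda$. $H(P|Q)=\int\log(dP/dQ)\,dP$ if $P\ll Q$ and $+\infty$ otherwise; $H(P|\Pi)=\inf_{Q\in\Pi}H(P|Q)$, $H(\Pi|Q)=\inf_{P\in\Pi}H(P|Q)$. Given a penalty $\mathrm{pen}(n,K)>0$, $\mathrm{crit}(n,K)=\sup_{\theta\in\Theta_K}\sum_{i=1}^n\ell_\theta(Z_i)-\mathrm{pen}(n,K)$, $\widehat K_n^L=\inf\{K\ge1:\mathrm{crit}(n,K)\ge\mathrm{crit}(n,K+1)\}$, and $\widehat K_n^G$ is the smallest maximizer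 of $K\mapsto\mathrm{crit}(n,K)$ (the maximization being over $1\le K\le K_{\max}$ when a known bound $K_{\max}\ge K^\star$ is assumed). All suprema are assumed measurable. Standing assumptions: (A1) each $(\Theta_K,d)$ is compact and each $\Pi_K$ is compact for the weak topology; (A2) for each $z$ and $K$, $\theta\mapsto\ell_\theta(z)$ is continuous on $\Theta_K$; (A3) there are $l,u:\mathcal Z\to\mathbb R$ with $u-l\in L^1(P^\star)$, $l\le\ell^\star\le u$ and $l\le\ell_\theta\le u$ for all $\theta\in\Theta_\infty$; (A4) for each $n$, $\mathrm{pen}(n,\cdot)$ is increasing, and for each $K$, $\mathrm{pen}(n,K)\to\infty$ and $\mathrm{pen}(n,K)=o(n)$ as $n\to\infty$. Additional notation: $\mathrm{Log}(x)=\log(\max(x,e))$, $\varphi(x)=x^2/\mathrm{Log}\,\mathrm{Log}(x)$; $\mathcal G^a_K=\{\ell_\theta-\ell^\star:\theta\in\Theta_K\}$. "$P^\star$-Donsker" is the standard notion for a class of functions (the empirical process indexed by the class converges weakly in $\ell^\infty$ of the class to a tight Gaussian process). *)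

theory Defs
  imports "HOL-Probability.Probability"
begin

definition Log :: "real \<Rightarrow> real" where
  "Log x = ln (max x (exp 1))"

definition varphi :: "real \<Rightarrow> real" where
  "varphi x = x\<^sup>2 / Log (Log x)"

definition prob_measures :: "'a::topological_space measure set" where
  "prob_measures = {P. prob_space P \<and> sets P = sets (borel :: 'a measure)}"

definition weak_topology :: "'a::topological_space measure topology" where
  "weak_topology = topology_generated_by
     {{P \<in> prob_measures. (\<integral>x. f x \<partial>P) \<in> U} | (f :: 'a \<Rightarrow> real) U.
        continuous_on UNIV f \<and> bounded (range f) \<and> open U}"

definition KL :: "'a measure \<Rightarrow> 'a measure \<Rightarrow> ereal" where
  "KL P Q = (if sets P = sets Q \<and> absolutely_continuous Q P then
      enn2ereal (\<integral>\<^sup>+x. ennreal (max 0 (ln (enn2real (RN_deriv Q P x)))) \<partial>P)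
    - enn2ereal (\<integral>\<^sup>+x. ennreal (max 0 (- ln (enn2real (RN_deriv Q P x)))) \<partial>P)
    else \<infinity>)"

definition KLset :: "'a measure \<Rightarrow> 'a measure set \<Rightarrow> ereal" where
  "KLset P Ms = (INF Q\<in>Ms. KL P Q)"

definition outer_exp :: "'w measure \<Rightarrow> ('w \<Rightarrow> real) \<Rightarrow> real" where
  "outer_exp M T = Inf {integral\<^sup>L M U | U. U \<in> borel_measurable M \<and> integrable M U
                          \<and> (\<forall>\<omega>\<in>space M. T \<omega> \<le> U \<omega>)}"

definition linf_metric :: "'f set \<Rightarrow> ('f \<Rightarrow> real) metric" where
  "linf_metric F = funspace F (euclidean_metric :: real metric)"

definition borel_of :: "'a topology \<Rightarrow> 'a measure" where
  "borel_of X = sigma (topspace X) {U. openin X U}"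

definition gaussian_law :: "real measure \<Rightarrow> bool" where
  "gaussian_law N \<longleftrightarrow>
     (\<exists>m \<sigma>. \<sigma> > 0 \<and> N = density lborel (normal_density m \<sigma>)) \<or> (\<exists>m. N = return borel m)"

definition emp_proc :: "'z measure \<Rightarrow> ('z \<Rightarrow> real) set \<Rightarrow> nat \<Rightarrow> (nat \<Rightarrow> 'z) \<Rightarrow> ('z \<Rightarrow> real) \<Rightarrow> real" where
  "emp_proc P F n \<omega> = restrict (\<lambda>f. sqrt (real n) * ((\<Sum>i<n. f (\<omega> i)) / real n - (\<integral>x. f x \<partial>P))) F"

text \<open>F is P-Donsker: the empirical process converges weakly (in the Hoffmann-Joergensen sense,
  with outer expectations) in l-infinity(F) to a tight Borel measurable Gaussian process.\<close>
definition donsker :: "'z measure \<Rightarrow> ('z \<Rightarrow> real) set \<Rightarrow> bool" where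
  "donsker P F \<longleftrightarrow>
     (\<forall>f\<in>F. integrable P f) \<and>
     (\<forall>x. bdd_above ((\<lambda>f. \<bar>f x - (\<integral>y. f y \<partial>P)\<bar>) ` F)) \<and>
     (\<exists>L. prob_space L \<and> sets L = sets (borel_of (mtopology_of (linf_metric F))) \<and>
        (\<forall>e>0. \<exists>K. compactin (mtopology_of (linf_metric F)) K \<and> measure L K \<ge> 1 - e) \<and>
        (\<forall>S a. finite S \<and> S \<subseteq> F \<longrightarrow>
            gaussian_law (distr L borel (\<lambda>g. \<Sum>f\<in>S. a f * g f))) \<and>
        (\<forall>h. continuous_map (mtopology_of (linf_metric F)) euclideanreal h \<and>
             bounded (h ` topspace (mtopology_of (linf_metric F))) \<longrightarrow>
           (\<lambda>n. outer_exp (PiM UNIV (\<lambda>_::nat. P)) (\<lambda>\<omega>. h (emp_proc P F n \<omega>)))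
             \<longlonglongrightarrow> (\<integral>g. h g \<partial>L)))"

definition models :: "'z measure \<Rightarrow> ('t \<Rightarrow> 'z \<Rightarrow> real) \<Rightarrow> (nat \<Rightarrow> 't set) \<Rightarrow> nat \<Rightarrow> 'z measure set" where
  "models mu p Theta K = (if K = 0 then {} else {density mu (p \<theta>) | \<theta>. \<theta> \<in> Theta K})"

definition Ga :: "('t \<Rightarrow> 'z \<Rightarrow> real) \<Rightarrow> ('z \<Rightarrow> real) \<Rightarrow> (nat \<Rightarrow> 't set) \<Rightarrow> nat \<Rightarrow> ('z \<Rightarrow> real) set" where
  "Ga p pstar Theta K = {(\<lambda>z. ln (p \<theta> z) - ln (pstar z)) | \<theta>. \<theta> \<in> Theta K}"

text \<open>crit(n,K) = sup over Theta_K of the log-likelihood of Z_1..Z_n minus pen(n,K)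
  (the observations Z_1, ..., Z_n are Z 0, ..., Z (n-1) here).\<close>
definition crit :: "('t \<Rightarrow> 'z \<Rightarrow> real) \<Rightarrow> (nat \<Rightarrow> 't set) \<Rightarrow> (nat \<Rightarrow> nat \<Rightarrow> real)
                    \<Rightarrow> (nat \<Rightarrow> 'w \<Rightarrow> 'z) \<Rightarrow> nat \<Rightarrow> nat \<Rightarrow> 'w \<Rightarrow> ereal" where
  "crit p Theta pen Z n K \<omega> =
     (SUP \<theta>\<in>Theta K. ereal (\<Sum>i<n. ln (p \<theta> (Z i \<omega>)))) - ereal (pen n K)"

definition KhatL :: "('t \<Rightarrow> 'z \<Rightarrow> real) \<Rightarrow> (nat \<Rightarrow> 't set) \<Rightarrow> (nat \<Rightarrow> nat \<Rightarrow> real)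
                    \<Rightarrow> (nat \<Rightarrow> 'w \<Rightarrow> 'z) \<Rightarrow> nat \<Rightarrow> 'w \<Rightarrow> enat" where
  "KhatL p Theta pen Z n \<omega> =
     (INF K\<in>{K. 1 \<le> K \<and> crit p Theta pen Z n K \<omega> \<ge> crit p Theta pen Z n (Suc K) \<omega>}. enat K)"

definition KhatG :: "('t \<Rightarrow> 'z \<Rightarrow> real) \<Rightarrow> (nat \<Rightarrow> 't set) \<Rightarrow> (nat \<Rightarrow> nat \<Rightarrow> real)
                    \<Rightarrow> (nat \<Rightarrow> 'w \<Rightarrow> 'z) \<Rightarrow> nat \<Rightarrow> nat \<Rightarrow> 'w \<Rightarrow> nat" where
  "KhatG p Theta pen Z Kmax n \<omega> =
     (LEAST K. K \<in> {1..Kmax} \<and>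
        (\<forall>K'\<in>{1..Kmax}. crit p Theta pen Z n K' \<omega> \<le> crit p Theta pen Z n K \<omega>))"

end

theory Submission
  imports Defs
begin

text \<open>
  Everything follows from a bounded law of the iterated logarithm: if the class of log-likelihood
  ratios f is P-Donsker and its envelope G satisfies \<^term>\<open>integrable P (\<lambda>z. varphi (G z))\<close>,
  then almost surely the centred sums of f are O(sqrt(n log log n)), uniformly in f. This is
  negligible against the penalty, so no model above the true order can beat the true one; being
  also o(n), it replaces the uniform law of large numbers that rules out the smaller models,
  whose Kullback-Leibler divergences are strictly worse.

  For the law of the iterated logarithm, the Donsker property is only used to see that the norm of
  the n-th sum is bounded in probability by a multiple of sqrt(n). Let n = 2^k, m = log log n and
  truncate the summands at a multiple of sqrt(n / m). The partial sums of n / m truncated summands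
  exceed a level of order sqrt(n / m) with small probability, so, restarting at each passage of
  that level, the first n partial sums reach a large multiple of m * sqrt(n / m) = sqrt(n m) only
  with probability exp(-2 m), which is summable in k. The norms of the remaining summands are
  added up and controlled by Chernoff's bound and the moment condition.
\<close>

section \<open>Sums of independent processes\<close>

text \<open>Integrability of \<open>varphi\<close> of the envelope does not provide a second moment,
  so summands between sqrt(n / m) and sqrt(n m) cannot be absorbed into a variance. Tightness itself
  supplies the substitute. A summand is the difference of two consecutive partial sums, so with high
  probability r independent summands all have norm at most 4 A sqrt(r), which forces a tail of at
  most 1 / r beyond that level. This weak second moment bounds the mean of what truncation removes;
  \<open>varphi\<close> enters only through the fluctuation of the removed part, by a truncated
  fourth moment.

  The truncation level for n is exactly this one for blocks of r = n / m summands. Hence truncation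
  changes nothing on a likely event, and the truncated sums inherit the bound on a passage within
  one block although they are no longer centred: the restart argument sees only independence, the
  bounded overshoot and that one probability.\<close>

definition seq_shift :: "nat \<Rightarrow> (nat \<Rightarrow> 'z) \<Rightarrow> nat \<Rightarrow> 'z" where
  "seq_shift k \<omega> = (\<lambda>i. \<omega> (k + i))"

text \<open>The index runs over the naturals so that the supremum is measurable; \<open>g\<close>
  will list the centred functions of a dense sequence of parameters.\<close>

definition supsum :: "(nat \<Rightarrow> 'z \<Rightarrow> real) \<Rightarrow> nat \<Rightarrow> (nat \<Rightarrow> 'z) \<Rightarrow> real" where
  "supsum g n \<omega> = (SUP j. \<bar>\<Sum>i<n. g j (\<omega> i)\<bar>)"

definition sup_norm :: "(nat \<Rightarrow> 'z \<Rightarrow> real) \<Rightarrow> 'z \<Rightarrow> real" where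
  "sup_norm g z = (SUP j. \<bar>g j z\<bar>)"

definition pointwise_bounded :: "(nat \<Rightarrow> 'z \<Rightarrow> real) \<Rightarrow> bool" where
  "pointwise_bounded g \<longleftrightarrow> (\<forall>z. bdd_above (range (\<lambda>j. \<bar>g j z\<bar>)))"

lemma abs_le_sup_norm: "pointwise_bounded g \<Longrightarrow> \<bar>g j z\<bar> \<le> sup_norm g z"
  unfolding pointwise_bounded_def sup_norm_def by (auto intro: cSUP_upper)

lemma sup_norm_nonneg: "pointwise_bounded g \<Longrightarrow> 0 \<le> sup_norm g z"
  using abs_le_sup_norm[of g 0 z] by linarith

lemma bdd_above_abs_sum:
  assumes "pointwise_bounded g"
  shows "bdd_above (range (\<lambda>j. \<bar>\<Sum>i<n. g j (\<omega> i)\<bar>))"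
proof (rule bdd_aboveI2)
  fix j
  have "\<bar>\<Sum>i<n. g j (\<omega> i)\<bar> \<le> (\<Sum>i<n. \<bar>g j (\<omega> i)\<bar>)" by (rule sum_abs)
  also have "\<dots> \<le> (\<Sum>i<n. sup_norm g (\<omega> i))"
    by (intro sum_mono abs_le_sup_norm assms)
  finally show "\<bar>\<Sum>i<n. g j (\<omega> i)\<bar> \<le> (\<Sum>i<n. sup_norm g (\<omega> i))" .
qed

lemma abs_sum_le_supsum: "pointwise_bounded g \<Longrightarrow> \<bar>\<Sum>i<n. g j (\<omega> i)\<bar> \<le> supsum g n \<omega>"
  unfolding supsum_def by (intro cSUP_upper bdd_above_abs_sum) auto

lemma supsum_least: "(\<And>j. \<bar>\<Sum>i<n. g j (\<omega> i)\<bar> \<le> c) \<Longrightarrow> supsum g n \<omega> \<le> c"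
  unfolding supsum_def by (intro cSUP_least) auto

lemma supsum_0 [simp]: "supsum g 0 \<omega> = 0"
  by (simp add: supsum_def)

lemma sum_shift:
  fixes f :: "'z \<Rightarrow> real"
  shows "(\<Sum>i<k + n. f (\<omega> i)) = (\<Sum>i<k. f (\<omega> i)) + (\<Sum>i<n. f (seq_shift k \<omega> i))"
  by (induction n) (auto simp: seq_shift_def)

lemma supsum_add_le:
  assumes "pointwise_bounded g"
  shows "supsum g (k + n) \<omega> \<le> supsum g k \<omega> + supsum g n (seq_shift k \<omega>)"
proof (rule supsum_least)
  fix j
  show "\<bar>\<Sum>i<k + n. g j (\<omega> i)\<bar> \<le> supsum g k \<omega> + supsum g n (seq_shift k \<omega>)"
    using abs_sum_le_supsum[OF assms, of j \<omega> k] abs_sum_le_supsum[OF assms, of j "seq_shift k \<omega>" n]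
    unfolding sum_shift by linarith
qed

lemma supsum_le_add:
  assumes "pointwise_bounded g"
  shows "supsum g k \<omega> \<le> supsum g (k + n) \<omega> + supsum g n (seq_shift k \<omega>)"
proof (rule supsum_least)
  fix j
  show "\<bar>\<Sum>i<k. g j (\<omega> i)\<bar> \<le> supsum g (k + n) \<omega> + supsum g n (seq_shift k \<omega>)"
    using abs_sum_le_supsum[OF assms, of j \<omega> "k + n"] abs_sum_le_supsum[OF assms, of j "seq_shift k \<omega>" n]
    unfolding sum_shift by linarith
qed

text \<open>A summand is the difference of two consecutive partial sums; this carries bounds on sums
  over to the norms of single summands.\<close>

lemma sup_norm_le_supsum:
  assumes "pointwise_bounded g"
  shows "sup_norm g (\<omega> k) \<le> supsum g (Suc k) \<omega> + supsum g k \<omega>"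
  unfolding sup_norm_def
proof (rule cSUP_least)
  fix j
  show "\<bar>g j (\<omega> k)\<bar> \<le> supsum g (Suc k) \<omega> + supsum g k \<omega>"
    using abs_sum_le_supsum[OF assms, of j \<omega> k] abs_sum_le_supsum[OF assms, of j \<omega> "Suc k"]
    by simp
qed auto

lemma supsum_Suc_le:
  assumes "pointwise_bounded g"
  shows "supsum g (Suc k) \<omega> \<le> supsum g k \<omega> + sup_norm g (\<omega> k)"
proof (rule supsum_least)
  fix j
  show "\<bar>\<Sum>i<Suc k. g j (\<omega> i)\<bar> \<le> supsum g k \<omega> + sup_norm g (\<omega> k)"
    using abs_sum_le_supsum[OF assms, of j \<omega> k] abs_le_sup_norm[OF assms, of j "\<omega> k"]
    by simp
qed

lemma supsum_cong: "(\<And>i j. i < n \<Longrightarrow> g j (\<omega> i) = h j (\<omega>' i)) \<Longrightarrow> supsum g n \<omega> = supsum h n \<omega>'"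
  unfolding supsum_def by (intro SUP_cong arg_cong[where f=abs] sum.cong) auto

lemma supsum_measurable [measurable (raw)]:
  assumes "pointwise_bounded g" and [measurable]: "\<And>j. g j \<in> borel_measurable M"
  shows "supsum g n \<in> borel_measurable (PiM UNIV (\<lambda>_::nat. M))"
  unfolding supsum_def[abs_def]
  by (intro borel_measurable_cSUP bdd_above_abs_sum assms(1)) auto

lemma sup_norm_measurable [measurable (raw)]:
  assumes "pointwise_bounded g" and [measurable]: "\<And>j. g j \<in> borel_measurable M"
  shows "sup_norm g \<in> borel_measurable M"
  unfolding sup_norm_def[abs_def]
  using assms(1) by (intro borel_measurable_cSUP) (auto simp: pointwise_bounded_def)

lemma seq_shift_measurable [measurable]:
  "seq_shift k \<in> measurable (PiM UNIV (\<lambda>_::nat. M)) (PiM UNIV (\<lambda>_::nat. M))"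
  unfolding seq_shift_def[abs_def]
  by (rule measurable_PiM_single') (auto simp: space_PiM PiE_iff)

lemma supsum_shift_measurable [measurable (raw)]:
  assumes "pointwise_bounded g" and "\<And>j. g j \<in> borel_measurable M"
  shows "(\<lambda>\<omega>. supsum g n (seq_shift k \<omega>)) \<in> borel_measurable (PiM UNIV (\<lambda>_::nat. M))"
  by (rule measurable_compose[OF seq_shift_measurable supsum_measurable[OF assms]])

section \<open>Independence along first passage times\<close>

context sequence_space
begin

text \<open>\<open>comb_seq\<close> splices a prefix of one sequence with a whole second sequence,
  and the splice of two independent copies again has law \<open>S\<close>. Under the splice the
  event is a rectangle, because \<open>A\<close> sees only the prefix and \<open>B\<close> only the
  rest. Summed over \<open>j\<close>, this acts as the strong Markov property at a first
  passage.\<close>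

lemma prob_prefix_shift:
  assumes A [measurable]: "Measurable.pred S A" and B [measurable]: "Measurable.pred S B"
    and dep: "\<And>\<omega> \<omega>'. (\<And>i. i < j \<Longrightarrow> \<omega> i = \<omega>' i) \<Longrightarrow> A \<omega> = A \<omega>'"
  shows "\<P>(\<omega> in S. A \<omega> \<and> B (seq_shift j \<omega>)) = \<P>(\<omega> in S. A \<omega>) * \<P>(\<omega> in S. B \<omega>)"
proof -
  have *: "A (comb_seq j \<omega> \<omega>') = A \<omega>" "seq_shift j (comb_seq j \<omega> \<omega>') = \<omega>'" for \<omega> \<omega>'
    by (auto simp: comb_seq_def seq_shift_def intro!: dep)
  have "emeasure S {\<omega>\<in>space S. A \<omega> \<and> B (seq_shift j \<omega>)}
    = emeasure (distr (S \<Otimes>\<^sub>M S) S (\<lambda>(\<omega>, \<omega>'). comb_seq j \<omega> \<omega>')) {\<omega>\<in>space S. A \<omega> \<and> B (seq_shift j \<omega>)}"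
    by (simp add: PiM_comb_seq)
  also have "\<dots> = emeasure (S \<Otimes>\<^sub>M S) ({\<omega>\<in>space S. A \<omega>} \<times> {\<omega>\<in>space S. B \<omega>})"
  proof (subst emeasure_distr[OF measurable_comb_seq])
    have "comb_seq j \<omega> \<omega>' \<in> space S \<longleftrightarrow> True" if "\<omega> \<in> space S" "\<omega>' \<in> space S" for \<omega> \<omega>'
      using that by (auto simp: space_PiM comb_seq_def PiE_iff)
    then show "emeasure (S \<Otimes>\<^sub>M S) ((\<lambda>(\<omega>, \<omega>'). comb_seq j \<omega> \<omega>') -`
        {\<omega>\<in>space S. A \<omega> \<and> B (seq_shift j \<omega>)} \<inter> space (S \<Otimes>\<^sub>M S))
      = emeasure (S \<Otimes>\<^sub>M S) ({\<omega>\<in>space S. A \<omega>} \<times> {\<omega>\<in>space S. B \<omega>})"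
      by (intro arg_cong[where f="emeasure _"]) (auto simp: * space_pair_measure)
  qed measurable
  also have "\<dots> = emeasure S {\<omega>\<in>space S. A \<omega>} * emeasure S {\<omega>\<in>space S. B \<omega>}"
    by (intro P.emeasure_pair_measure_Times) auto
  finally show ?thesis
    by (simp add: P.emeasure_eq_measure flip: ennreal_mult')
qed

lemma nn_integral_prod_iid:
  fixes h :: "'a \<Rightarrow> ennreal"
  assumes [measurable]: "h \<in> borel_measurable M"
  shows "(\<integral>\<^sup>+\<omega>. (\<Prod>i<n. h (\<omega> i)) \<partial>S) = (\<integral>\<^sup>+z. h z \<partial>M) ^ n"
proof (induction n)
  case 0
  then show ?case by (simp add: P.emeasure_space_1)
next
  case (Suc n)
  have "(\<integral>\<^sup>+\<omega>. (\<Prod>i<Suc n. h (\<omega> i)) \<partial>S)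
    = (\<integral>\<^sup>+\<omega>. (\<Prod>i<Suc n. h (\<omega> i)) \<partial>(distr (M \<Otimes>\<^sub>M S) S (\<lambda>(s, \<omega>). case_nat s \<omega>)))"
    by (simp add: PiM_iter)
  also have "\<dots> = (\<integral>\<^sup>+x. h (fst x) * (\<Prod>i<n. h (snd x i)) \<partial>(M \<Otimes>\<^sub>M S))"
    by (subst nn_integral_distr)
       (auto intro!: nn_integral_cong simp: split_beta' prod.lessThan_Suc_shift simp del: prod.lessThan_Suc)
  also have "\<dots> = (\<integral>\<^sup>+s. \<integral>\<^sup>+\<omega>. h s * (\<Prod>i<n. h (\<omega> i)) \<partial>S \<partial>M)"
    by (subst P.nn_integral_fst[symmetric]) auto
  also have "\<dots> = (\<integral>\<^sup>+s. h s \<partial>M) * (\<integral>\<^sup>+\<omega>. (\<Prod>i<n. h (\<omega> i)) \<partial>S)"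
    by (simp add: nn_integral_cmult nn_integral_multc)
  finally show ?case using Suc by simp
qed

definition first_passage :: "(nat \<Rightarrow> 'a \<Rightarrow> real) \<Rightarrow> real \<Rightarrow> nat \<Rightarrow> (nat \<Rightarrow> 'a) \<Rightarrow> bool" where
  "first_passage g t j \<omega> \<longleftrightarrow> t < supsum g j \<omega> \<and> (\<forall>i<j. supsum g i \<omega> \<le> t)"

lemma first_passage_unique: "first_passage g t i \<omega> \<Longrightarrow> first_passage g t j \<omega> \<Longrightarrow> i = j"
  unfolding first_passage_def by (metis linorder_neqE_nat not_less)

lemma ex_first_passage:
  assumes "t < supsum g k \<omega>"
  obtains j where "j \<le> k" "first_passage g t j \<omega>"
proof -
  define j where "j = (LEAST j. t < supsum g j \<omega>)"
  have "t < supsum g j \<omega>" unfolding j_def by (rule LeastI[of _ k]) (rule assms)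
  moreover have "j \<le> k" unfolding j_def by (rule Least_le) (rule assms)
  moreover have "supsum g i \<omega> \<le> t" if "i < j" for i
    using not_less_Least[of i "\<lambda>j. t < supsum g j \<omega>"] that by (auto simp: j_def not_less)
  ultimately show ?thesis using that by (auto simp: first_passage_def)
qed

lemma first_passage_prefix:
  assumes "\<And>i. i < j \<Longrightarrow> \<omega> i = \<omega>' i"
  shows "first_passage g t j \<omega> = first_passage g t j \<omega>'"
proof -
  have "supsum g k \<omega> = supsum g k \<omega>'" if "k \<le> j" for k
    using assms that by (intro supsum_cong) auto
  then show ?thesis by (auto simp: first_passage_def)
qed

lemma first_passage_measurable [measurable (raw)]:
  assumes [simp]: "pointwise_bounded g" and [measurable]: "\<And>j. g j \<in> borel_measurable M"
  shows "Measurable.pred S (first_passage g t j)"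
  unfolding first_passage_def[abs_def] by measurable

lemma sum_first_passage:
  assumes [simp]: "pointwise_bounded g" and [measurable]: "\<And>j. g j \<in> borel_measurable M"
  shows "(\<Sum>j\<le>n. \<P>(\<omega> in S. first_passage g t j \<omega>)) = \<P>(\<omega> in S. \<exists>k\<le>n. t < supsum g k \<omega>)"
proof -
  have "(\<Sum>j\<le>n. \<P>(\<omega> in S. first_passage g t j \<omega>)) = P.prob (\<Union>j\<le>n. {\<omega>\<in>space S. first_passage g t j \<omega>})"
    by (intro P.finite_measure_finite_Union[symmetric])
       (auto simp: disjoint_family_on_def dest: first_passage_unique)
  also have "(\<Union>j\<le>n. {\<omega>\<in>space S. first_passage g t j \<omega>}) = {\<omega>\<in>space S. \<exists>k\<le>n. t < supsum g k \<omega>}"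
  proof (intro set_eqI iffI)
    fix \<omega> assume "\<omega> \<in> {\<omega>\<in>space S. \<exists>k\<le>n. t < supsum g k \<omega>}"
    then obtain k where k: "\<omega> \<in> space S" "k \<le> n" "t < supsum g k \<omega>" by auto
    from k(3) obtain j where "j \<le> k" "first_passage g t j \<omega>" by (rule ex_first_passage)
    with k show "\<omega> \<in> (\<Union>j\<le>n. {\<omega>\<in>space S. first_passage g t j \<omega>})" by auto
  qed (auto simp: first_passage_def)
  finally show ?thesis .
qed

text \<open>Passages at different times are disjoint events, so restarting at the passage time costs
  no union bound.\<close>

lemma sum_first_passage_shift_le:
  assumes [simp]: "pointwise_bounded g" and [measurable]: "\<And>j. g j \<in> borel_measurable M"
    and [measurable]: "\<And>j. Measurable.pred S (B j)" and [measurable]: "Measurable.pred S C"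
    and imp: "\<And>j \<omega>. j \<le> n \<Longrightarrow> first_passage g t j \<omega> \<Longrightarrow> B j (seq_shift j \<omega>) \<Longrightarrow> C \<omega>"
  shows "(\<Sum>j\<le>n. \<P>(\<omega> in S. first_passage g t j \<omega>) * \<P>(\<omega> in S. B j \<omega>)) \<le> \<P>(\<omega> in S. C \<omega>)"
proof -
  have "(\<Sum>j\<le>n. \<P>(\<omega> in S. first_passage g t j \<omega>) * \<P>(\<omega> in S. B j \<omega>))
      = (\<Sum>j\<le>n. \<P>(\<omega> in S. first_passage g t j \<omega> \<and> B j (seq_shift j \<omega>)))"
    by (intro sum.cong refl prob_prefix_shift[symmetric] first_passage_prefix) auto
  also have "\<dots> = P.prob (\<Union>j\<le>n. {\<omega>\<in>space S. first_passage g t j \<omega> \<and> B j (seq_shift j \<omega>)})"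
    by (intro P.finite_measure_finite_Union[symmetric])
       (auto simp: disjoint_family_on_def dest: first_passage_unique)
  also have "\<dots> \<le> \<P>(\<omega> in S. C \<omega>)"
    by (intro P.finite_measure_mono) (auto intro: imp)
  finally show ?thesis .
qed

text \<open>Ottaviani's inequality: after a passage of \<open>2 * t\<close> at time
  \<open>j\<close>, the remaining \<open>n - j\<close> summands have norm above \<open>t\<close>
  with probability at most \<open>q\<close>, independently of the past. Otherwise the final sum
  cannot have come back to \<open>t\<close>.\<close>

lemma ottaviani_ineq:
  assumes [simp]: "pointwise_bounded g" and [measurable]: "\<And>j. g j \<in> borel_measurable M"
    and q: "\<And>i. i \<le> n \<Longrightarrow> \<P>(\<omega> in S. t < supsum g i \<omega>) \<le> q"
  shows "(1 - q) * \<P>(\<omega> in S. \<exists>k\<le>n. 2 * t < supsum g k \<omega>) \<le> \<P>(\<omega> in S. t < supsum g n \<omega>)"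
proof -
  have "(1 - q) * \<P>(\<omega> in S. \<exists>k\<le>n. 2 * t < supsum g k \<omega>)
    = (\<Sum>j\<le>n. \<P>(\<omega> in S. first_passage g (2 * t) j \<omega>) * (1 - q))"
    by (simp add: sum_first_passage[symmetric] sum_distrib_left mult.commute)
  also have "\<dots> \<le> (\<Sum>j\<le>n. \<P>(\<omega> in S. first_passage g (2 * t) j \<omega>) * \<P>(\<omega> in S. supsum g (n - j) \<omega> \<le> t))"
  proof (intro sum_mono mult_left_mono measure_nonneg)
    fix j
    have "\<P>(\<omega> in S. \<not> t < supsum g (n - j) \<omega>) = 1 - \<P>(\<omega> in S. t < supsum g (n - j) \<omega>)"
      by (intro P.prob_neg) auto
    then show "1 - q \<le> \<P>(\<omega> in S. supsum g (n - j) \<omega> \<le> t)"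
      using q[of "n - j"] by (simp add: not_less)
  qed
  also have "\<dots> \<le> \<P>(\<omega> in S. t < supsum g n \<omega>)"
  proof (rule sum_first_passage_shift_le)
    fix j \<omega> assume "j \<le> n" "first_passage g (2 * t) j \<omega>" "supsum g (n - j) (seq_shift j \<omega>) \<le> t"
    then show "t < supsum g n \<omega>"
      using supsum_le_add[of g j \<omega> "n - j"] by (simp add: first_passage_def)
  qed auto
  finally show ?thesis .
qed

text \<open>The Laplace transform at 1/r of the passage time over level T is at most q + exp (-1); a
  passage over level l (T + b) requires l independent such passages, each overshooting by at most b.\<close>

lemma passage_bound:
  assumes [simp]: "pointwise_bounded g" and [measurable]: "\<And>j. g j \<in> borel_measurable M"
    and b: "\<And>z. sup_norm g z \<le> b" and T: "0 \<le> T" and r: "0 < r"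
    and q: "\<P>(\<omega> in S. \<exists>k\<le>r. T < supsum g k \<omega>) \<le> q"
  shows "\<P>(\<omega> in S. \<exists>k\<le>n. real l * (T + b) < supsum g k \<omega>)
           \<le> exp (real n / real r) * (q + exp (-1)) ^ l"
proof (induction l arbitrary: n)
  case 0
  have "\<P>(\<omega> in S. \<exists>k\<le>n. real 0 * (T + b) < supsum g k \<omega>) \<le> 1"
    by (rule P.prob_le_1)
  also have "1 \<le> exp (real n / real r)" by simp
  finally show ?case by simp
next
  case (Suc l)
  let ?\<rho> = "q + exp (-1)"
  let ?F = "\<lambda>j. \<P>(\<omega> in S. first_passage g T j \<omega>)"
  have q0: "0 \<le> q" using q by (rule order.trans[OF measure_nonneg])
  have b0: "0 \<le> b" using b[of undefined] sup_norm_nonneg[of g undefined] by simp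
  have "\<P>(\<omega> in S. \<exists>k\<le>n. real (Suc l) * (T + b) < supsum g k \<omega>)
    \<le> P.prob (\<Union>j\<le>n. {\<omega>\<in>space S. first_passage g T j \<omega> \<and>
          (\<exists>k\<le>n - j. real l * (T + b) < supsum g k (seq_shift j \<omega>))})"
  proof (intro P.finite_measure_mono subsetI)
    fix \<omega> assume "\<omega> \<in> {\<omega>\<in>space S. \<exists>k\<le>n. real (Suc l) * (T + b) < supsum g k \<omega>}"
    then obtain k where "\<omega> \<in> space S" and k: "k \<le> n" "real (Suc l) * (T + b) < supsum g k \<omega>"
      by auto
    have lT: "0 \<le> real l * (T + b)" using T b0 by simp
    then have "T < supsum g k \<omega>" using k b0 by (simp add: algebra_simps)
    then obtain j where j: "j \<le> k" "first_passage g T j \<omega>" by (rule ex_first_passage)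
    \<comment> \<open>The empty sum has norm 0, which is not above \<open>T\<close>, so the passage
      has a last summand. The overshoot is at most its norm, hence at most \<open>b\<close>.\<close>
    have "j \<noteq> 0" using j T by (intro notI) (simp add: first_passage_def)
    then obtain j' where j': "j = Suc j'" by (cases j) auto
    have "supsum g j \<omega> \<le> T + b"
      using supsum_Suc_le[of g j' \<omega>] j b[of "\<omega> j'"] by (auto simp: j' first_passage_def)
    with supsum_add_le[of g j "k - j" \<omega>] k j
    have "real l * (T + b) < supsum g (k - j) (seq_shift j \<omega>)" by (simp add: algebra_simps)
    with j k \<open>\<omega> \<in> space S\<close>
    show "\<omega> \<in> (\<Union>j\<le>n. {\<omega>\<in>space S. first_passage g T j \<omega> \<and>
          (\<exists>k\<le>n - j. real l * (T + b) < supsum g k (seq_shift j \<omega>))})"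
      by (auto intro!: bexI[of _ j] exI[of _ "k - j"])
  qed (intro sets.finite_UN; measurable)
  also have "\<dots> \<le> (\<Sum>j\<le>n. \<P>(\<omega> in S. first_passage g T j \<omega> \<and>
          (\<exists>k\<le>n - j. real l * (T + b) < supsum g k (seq_shift j \<omega>))))"
    by (intro P.finite_measure_subadditive_finite) auto
  also have "\<dots> = (\<Sum>j\<le>n. ?F j * \<P>(\<omega> in S. \<exists>k\<le>n - j. real l * (T + b) < supsum g k \<omega>))"
    by (intro sum.cong refl prob_prefix_shift first_passage_prefix) auto
  \<comment> \<open>The induction hypothesis with horizon \<open>n - j\<close> splits off the factor
    \<open>exp (- real j / real r)\<close>; what remains is the Laplace transform of the passage
    time.\<close>
  also have "\<dots> \<le> (\<Sum>j\<le>n. ?F j * (exp (real n / real r) * ?\<rho> ^ l * exp (- real j / real r)))"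
  proof (intro sum_mono mult_left_mono measure_nonneg)
    fix j assume "j \<in> {..n}"
    then have "exp (real (n - j) / real r) = exp (real n / real r) * exp (- real j / real r)"
      by (simp add: exp_add[symmetric] of_nat_diff diff_divide_distrib)
    with Suc.IH[of "n - j"]
    show "\<P>(\<omega> in S. \<exists>k\<le>n - j. real l * (T + b) < supsum g k \<omega>)
         \<le> exp (real n / real r) * ?\<rho> ^ l * exp (- real j / real r)"
      by (simp add: algebra_simps)
  qed
  also have "\<dots> = exp (real n / real r) * ?\<rho> ^ l * (\<Sum>j\<le>n. ?F j * exp (- real j / real r))"
    by (simp add: sum_distrib_left algebra_simps)
  also have "\<dots> \<le> exp (real n / real r) * ?\<rho> ^ l * ?\<rho>"
  proof (intro mult_left_mono mult_nonneg_nonneg zero_le_power add_nonneg_nonneg q0)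
    \<comment> \<open>Passages up to time \<open>r\<close> have weight at most 1 and total
      probability at most \<open>q\<close>; later ones have weight at most \<open>exp (-1)\<close>
      and total probability at most 1.\<close>
    have "(\<Sum>j\<le>n. ?F j * exp (- real j / real r))
        \<le> (\<Sum>j\<le>n. (if j \<le> r then ?F j else 0) + exp (-1) * ?F j)"
    proof (rule sum_mono)
      fix j
      show "?F j * exp (- real j / real r) \<le> (if j \<le> r then ?F j else 0) + exp (-1) * ?F j"
      proof (cases "j \<le> r")
        case True
        have "?F j * exp (- real j / real r) \<le> ?F j * 1" by (intro mult_left_mono) auto
        moreover have "0 \<le> exp (-1) * ?F j" by simp
        ultimately have "?F j * exp (- real j / real r) \<le> ?F j + exp (-1) * ?F j" by linarith
        then show ?thesis using True by simp
      next
        case False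
        then have "exp (- real j / real r) \<le> exp (-1)" using r by (simp add: field_simps)
        then have "?F j * exp (- real j / real r) \<le> ?F j * exp (-1)" by (intro mult_left_mono) auto
        then show ?thesis using False by (simp add: mult.commute)
      qed
    qed
    also have "\<dots> = (\<Sum>j\<in>{j\<in>{..n}. j \<le> r}. ?F j) + exp (-1) * (\<Sum>j\<le>n. ?F j)"
      by (simp only: sum.distrib sum_distrib_left sum.inter_filter finite_atMost)
    also have "\<dots> \<le> (\<Sum>j\<le>r. ?F j) + exp (-1) * 1"
      by (intro add_mono mult_left_mono sum_mono2) (auto simp: sum_first_passage)
    also have "\<dots> \<le> q + exp (-1)"
      using q by (simp add: sum_first_passage)
    finally show "(\<Sum>j\<le>n. ?F j * exp (- real j / real r)) \<le> ?\<rho>" .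
  qed auto
  also have "\<dots> = exp (real n / real r) * ?\<rho> ^ Suc l" by simp
  finally show ?case .
qed

end

section \<open>Truncation, and what tightness gives\<close>

text \<open>The cut depends on the norm of the summand and not on the index \<open>j\<close>: all
  components vanish together, and no sum changes as long as no norm exceeds \<open>b\<close>. There
  is no recentring.\<close>

definition trunc :: "real \<Rightarrow> (nat \<Rightarrow> 'z \<Rightarrow> real) \<Rightarrow> nat \<Rightarrow> 'z \<Rightarrow> real" where
  "trunc b g j z = (if sup_norm g z \<le> b then g j z else 0)"

definition excess :: "real \<Rightarrow> (nat \<Rightarrow> 'z \<Rightarrow> real) \<Rightarrow> 'z \<Rightarrow> real" where
  "excess b g z = (if sup_norm g z \<le> b then 0 else sup_norm g z)"

lemma pointwise_bounded_trunc [intro, simp]: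
  assumes "pointwise_bounded g"
  shows "pointwise_bounded (trunc b g)"
  unfolding pointwise_bounded_def
proof (intro allI bdd_aboveI2)
  fix z j show "\<bar>trunc b g j z\<bar> \<le> sup_norm g z"
    using abs_le_sup_norm[OF assms, of j z] sup_norm_nonneg[OF assms, of z] by (simp add: trunc_def)
qed

lemma sup_norm_trunc_le:
  assumes "pointwise_bounded g" "0 \<le> b"
  shows "sup_norm (trunc b g) z \<le> b"
  unfolding sup_norm_def[of "trunc b g"]
proof (rule cSUP_least)
  fix j show "\<bar>trunc b g j z\<bar> \<le> b"
    using abs_le_sup_norm[OF assms(1), of j z] assms(2) by (simp add: trunc_def)
qed auto

lemma trunc_measurable [measurable (raw)]:
  assumes [simp]: "pointwise_bounded g" and [measurable]: "\<And>j. g j \<in> borel_measurable M"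
  shows "trunc b g j \<in> borel_measurable M"
  unfolding trunc_def[abs_def] by measurable

lemma excess_measurable [measurable (raw)]:
  assumes [simp]: "pointwise_bounded g" and [measurable]: "\<And>j. g j \<in> borel_measurable M"
  shows "excess b g \<in> borel_measurable M"
  unfolding excess_def[abs_def] by measurable

lemma supsum_le_trunc_excess:
  assumes "pointwise_bounded g"
  shows "supsum g n \<omega> \<le> supsum (trunc b g) n \<omega> + (\<Sum>i<n. excess b g (\<omega> i))"
proof (rule supsum_least)
  fix j
  have "\<bar>\<Sum>i<n. g j (\<omega> i)\<bar> = \<bar>(\<Sum>i<n. trunc b g j (\<omega> i)) + (\<Sum>i<n. g j (\<omega> i) - trunc b g j (\<omega> i))\<bar>"
    by (simp add: sum_subtractf)
  also have "\<dots> \<le> \<bar>\<Sum>i<n. trunc b g j (\<omega> i)\<bar> + (\<Sum>i<n. \<bar>g j (\<omega> i) - trunc b g j (\<omega> i)\<bar>)"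
    by (rule order.trans[OF abs_triangle_ineq add_left_mono[OF sum_abs]])
  also have "\<dots> \<le> supsum (trunc b g) n \<omega> + (\<Sum>i<n. excess b g (\<omega> i))"
    by (intro add_mono abs_sum_le_supsum sum_mono pointwise_bounded_trunc assms)
       (auto simp: trunc_def excess_def intro: abs_le_sup_norm assms)
  finally show "\<bar>\<Sum>i<n. g j (\<omega> i)\<bar> \<le> supsum (trunc b g) n \<omega> + (\<Sum>i<n. excess b g (\<omega> i))" .
qed

text \<open>If \<open>p\<close> exceeded \<open>1 / real r\<close>, the power would be at most
  exp(-1) <= 1/2. This turns the probability that \<open>r\<close> independent summands are all
  small into a tail bound for one summand.\<close>

lemma le_inverse_if_power_ge:
  fixes p :: real
  assumes "0 \<le> p" "p \<le> 1" "6 / 7 \<le> (1 - p) ^ r" "0 < r"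
  shows "p \<le> 1 / real r"
proof (rule ccontr)
  assume "\<not> p \<le> 1 / real r"
  then have "1 < real r * p" using assms by (simp add: field_simps)
  have "(1 - p) ^ r \<le> exp (- p) ^ r"
    using assms exp_ge_add_one_self[of "- p"] by (intro power_mono) auto
  also have "\<dots> = exp (- (real r * p))" by (simp flip: exp_of_nat_mult)
  also have "\<dots> \<le> exp (-1)" using \<open>1 < real r * p\<close> by simp
  also have "\<dots> \<le> 1 / 2" using exp_ge_add_one_self[of 1] by (simp add: exp_minus field_simps)
  finally show False using assms by simp
qed

text \<open>The left side is the factor \<open>q + exp (-1)\<close> of \<open>passage_bound\<close>
  for \<open>q = 1 / 7\<close>. With x = exp(1/2) the claim reads x^2 <= 7 x - 7, and rough bounds
  on x suffice.\<close>

lemma one_seventh_plus_exp_minus_one_le: "1 / 7 + exp (-1) \<le> exp (-1/2 :: real)"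
proof -
  define x where "x = exp (1/2 :: real)"
  have x2: "x * x = exp 1" by (simp add: x_def flip: exp_add)
  have "3/2 \<le> x" using exp_ge_add_one_self[of "1/2"] by (simp add: x_def)
  moreover have "x \<le> 7/4"
    using exp_bound[of "1/2"] by (simp add: x_def power2_eq_square)
  ultimately have "0 \<le> (x - 3/2) * (7/4 - x)" by (intro mult_nonneg_nonneg) auto
  moreover have "(x - 3/2) * (7/4 - x) = 13/4 * x - x * x - 21/8" by (simp add: field_simps)
  ultimately have "x * x \<le> 7 * x - 7" using \<open>3/2 \<le> x\<close> by linarith
  then have "(x * x + 7) / (7 * (x * x)) \<le> 7 * x / (7 * (x * x))"
    by (intro divide_right_mono) auto
  then have "1 / 7 + 1 / (x * x) \<le> 1 / x" using \<open>3/2 \<le> x\<close> by (simp add: add_divide_distrib)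
  moreover have "exp (-1) = 1 / (x * x)" "exp (-1/2) = 1 / x"
    using exp_minus[of "1/2 :: real"] by (simp_all add: x2 exp_minus inverse_eq_divide flip: x_def)
  ultimately show ?thesis by (simp only:)
qed

context sequence_space
begin

lemma prob_all_lt:
  assumes [measurable]: "Measurable.pred M Q"
  shows "\<P>(\<omega> in S. \<forall>i<n. Q (\<omega> i)) = \<P>(z in M. Q z) ^ n"
proof -
  have "emeasure S {\<omega>\<in>space S. \<forall>i<n. Q (\<omega> i)} = (\<integral>\<^sup>+\<omega>. (\<Prod>i<n. indicator {z\<in>space M. Q z} (\<omega> i)) \<partial>S)"
  proof (subst nn_integral_indicator[symmetric])
    show "(\<integral>\<^sup>+\<omega>. indicator {\<omega>\<in>space S. \<forall>i<n. Q (\<omega> i)} \<omega> \<partial>S)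
        = (\<integral>\<^sup>+\<omega>. (\<Prod>i<n. indicator {z\<in>space M. Q z} (\<omega> i)) \<partial>S)"
    proof (rule nn_integral_cong)
      fix \<omega> assume "\<omega> \<in> space S"
      then show "indicator {\<omega>\<in>space S. \<forall>i<n. Q (\<omega> i)} \<omega> = (\<Prod>i<n. indicator {z\<in>space M. Q z} (\<omega> i) :: ennreal)"
        by (cases "\<forall>i<n. Q (\<omega> i)") (auto simp: indicator_def space_PiM PiE_iff intro!: prod_zero)
    qed
  qed measurable
  also have "\<dots> = (emeasure M {z\<in>space M. Q z}) ^ n"
    by (subst nn_integral_prod_iid) auto
  finally show ?thesis
    by (simp add: P.emeasure_eq_measure M.emeasure_eq_measure ennreal_power)
qed

context
  fixes g :: "nat \<Rightarrow> 'a \<Rightarrow> real" and A :: real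
  assumes bd [simp]: "pointwise_bounded g" and gm [measurable]: "\<And>j. g j \<in> borel_measurable M"
    and A: "0 < A" and tight: "\<And>n. 1 \<le> n \<Longrightarrow> \<P>(\<omega> in S. A * sqrt (real n) < supsum g n \<omega>) \<le> 1 / 8"
begin

lemma sup_norm_g_measurable [measurable]: "sup_norm g \<in> borel_measurable M"
  by (intro sup_norm_measurable bd gm)

lemma supsum_trunc_measurable [measurable]: "supsum (trunc b g) n \<in> borel_measurable S"
  by (intro supsum_measurable pointwise_bounded_trunc trunc_measurable bd gm)

text \<open>The bound is (1/8) / (1 - 1/8), from Ottaviani's inequality with q = 1/8.\<close>

lemma prob_max_supsum: "\<P>(\<omega> in S. \<exists>k\<le>r. 2 * (A * sqrt (real r)) < supsum g k \<omega>) \<le> 1 / 7"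
proof -
  have "\<P>(\<omega> in S. A * sqrt (real r) < supsum g k \<omega>) \<le> 1 / 8" if "k \<le> r" for k
  proof (cases "k = 0")
    case True
    moreover have "\<not> A * sqrt (real r) < 0" using A by (simp add: not_less)
    ultimately show ?thesis by simp
  next
    case False
    have "A * sqrt (real k) \<le> A * sqrt (real r)" using that A by simp
    then have "\<P>(\<omega> in S. A * sqrt (real r) < supsum g k \<omega>) \<le> \<P>(\<omega> in S. A * sqrt (real k) < supsum g k \<omega>)"
      by (intro P.finite_measure_mono) auto
    also have "\<dots> \<le> 1 / 8" using False by (intro tight) auto
    finally show ?thesis .
  qed
  note q = this
  have "(1 - 1/8) * \<P>(\<omega> in S. \<exists>k\<le>r. 2 * (A * sqrt (real r)) < supsum g k \<omega>)
    \<le> \<P>(\<omega> in S. A * sqrt (real r) < supsum g r \<omega>)"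
    by (intro ottaviani_ineq bd gm q)
  also have "\<dots> \<le> 1 / 8" by (rule q) simp
  finally show ?thesis by simp
qed

lemma sup_norm_le_of_max:
  assumes "\<And>k. k \<le> r \<Longrightarrow> supsum g k \<omega> \<le> 2 * t" "i < r"
  shows "sup_norm g (\<omega> i) \<le> 4 * t"
  using sup_norm_le_supsum[OF bd, of \<omega> i] assms(1)[of i] assms(1)[of "Suc i"] assms(2) by simp

text \<open>With probability at least 6/7 the first \<open>r\<close> sums stay below 2 A sqrt(r),
  and then all \<open>r\<close> summands have norm at most 4 A sqrt(r). By independence the r-th
  power of the probability of one small summand is at least 6/7. This is the weak second moment of
  the norm.\<close>

lemma prob_sup_norm_gt:
  assumes "0 < r"
  shows "\<P>(z in M. 4 * (A * sqrt (real r)) < sup_norm g z) \<le> 1 / real r"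
proof (rule le_inverse_if_power_ge)
  have "(1 - \<P>(z in M. 4 * (A * sqrt (real r)) < sup_norm g z)) ^ r = \<P>(z in M. \<not> 4 * (A * sqrt (real r)) < sup_norm g z) ^ r"
    by (subst M.prob_neg) auto
  also have "\<dots> = \<P>(\<omega> in S. \<forall>i<r. \<not> 4 * (A * sqrt (real r)) < sup_norm g (\<omega> i))"
    by (subst prob_all_lt) auto
  also have "\<dots> \<ge> \<P>(\<omega> in S. \<not> (\<exists>k\<le>r. 2 * (A * sqrt (real r)) < supsum g k \<omega>))"
    by (intro P.finite_measure_mono) (auto simp: not_less intro!: sup_norm_le_of_max[of r])
  also have "\<P>(\<omega> in S. \<not> (\<exists>k\<le>r. 2 * (A * sqrt (real r)) < supsum g k \<omega>))
      = 1 - \<P>(\<omega> in S. \<exists>k\<le>r. 2 * (A * sqrt (real r)) < supsum g k \<omega>)"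
    by (intro P.prob_neg) auto
  finally show "6 / 7 \<le> (1 - \<P>(z in M. 4 * (A * sqrt (real r)) < sup_norm g z)) ^ r"
    using prob_max_supsum[of r] by simp
qed (use assms in auto)

text \<open>While the original sums stay below the level, no summand exceeds twice that level, which
  is where the cut lies. Hence a passage of the truncated sums entails one of the original
  sums.\<close>

lemma prob_max_supsum_trunc:
  "\<P>(\<omega> in S. \<exists>k\<le>r. 2 * (A * sqrt (real r)) < supsum (trunc (4 * (A * sqrt (real r))) g) k \<omega>) \<le> 1 / 7"
proof -
  let ?t = "A * sqrt (real r)"
  have "\<P>(\<omega> in S. \<exists>k\<le>r. 2 * ?t < supsum (trunc (4 * ?t) g) k \<omega>)
      \<le> \<P>(\<omega> in S. \<exists>k\<le>r. 2 * ?t < supsum g k \<omega>)"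
  proof (intro P.finite_measure_mono subsetI)
    fix \<omega> assume "\<omega> \<in> {\<omega>\<in>space S. \<exists>k\<le>r. 2 * ?t < supsum (trunc (4 * ?t) g) k \<omega>}"
    then obtain k where \<omega>: "\<omega> \<in> space S" and k: "k \<le> r" "2 * ?t < supsum (trunc (4 * ?t) g) k \<omega>"
      by auto
    have "\<exists>k\<le>r. 2 * ?t < supsum g k \<omega>"
    proof (rule ccontr)
      assume *: "\<not> (\<exists>k\<le>r. 2 * ?t < supsum g k \<omega>)"
      then have "sup_norm g (\<omega> i) \<le> 4 * ?t" if "i < r" for i
        using that by (intro sup_norm_le_of_max[of r]) (auto simp: not_less)
      then have "supsum (trunc (4 * ?t) g) k \<omega> = supsum g k \<omega>"
        using k by (intro supsum_cong) (auto simp: trunc_def)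
      with * k show False by auto
    qed
    with \<omega> show "\<omega> \<in> {\<omega>\<in>space S. \<exists>k\<le>r. 2 * ?t < supsum g k \<omega>}" by simp
  qed measurable
  with prob_max_supsum[of r] show ?thesis by simp
qed

text \<open>The 6 is 2 + 4: the passage level plus an overshoot bounded by the truncation
  level.\<close>

lemma prob_max_trunc_passage:
  assumes "0 < r"
  shows "\<P>(\<omega> in S. \<exists>k\<le>n. real l * (6 * (A * sqrt (real r))) < supsum (trunc (4 * (A * sqrt (real r))) g) k \<omega>)
    \<le> exp (real n / real r - real l / 2)"
proof -
  let ?t = "A * sqrt (real r)"
  have t: "0 \<le> ?t" using A by simp
  have "\<P>(\<omega> in S. \<exists>k\<le>n. real l * (2 * ?t + 4 * ?t) < supsum (trunc (4 * ?t) g) k \<omega>)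
     \<le> exp (real n / real r) * (1 / 7 + exp (-1)) ^ l"
    using t assms by (intro passage_bound prob_max_supsum_trunc sup_norm_trunc_le) auto
  also have "\<dots> \<le> exp (real n / real r) * exp (-1/2) ^ l"
    by (intro mult_left_mono power_mono one_seventh_plus_exp_minus_one_le) auto
  also have "\<dots> = exp (real n / real r - real l / 2)"
    by (simp flip: exp_of_nat_mult exp_add)
  finally show ?thesis by simp
qed

end

end

section \<open>Large summands\<close>

text \<open>A power above 2 is wanted because the truncated moments must be summable over dyadic
  sample sizes. For l y > 1 put rho = 1 / y: then rho^4 <= 256 exp(rho), and rho - 1 <= (rho - 1) l
  y = l - l y. The constant comes from 256 * 3 <= 800.\<close>

lemma exp_mult_le_quartic:
  fixes y l :: real
  assumes "0 \<le> y" "y \<le> 1" "0 \<le> l"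
  shows "exp (l * y) \<le> 1 + 2 * l * y + 800 * exp l * y ^ 4"
proof (cases "l * y \<le> 1")
  case True
  have ly: "0 \<le> l * y" using assms by simp
  then have "exp (l * y) \<le> 1 + l * y + (l * y)\<^sup>2" using True by (intro exp_bound)
  also have "(l * y)\<^sup>2 \<le> l * y"
    using mult_left_mono[OF True ly] by (simp add: power2_eq_square)
  finally have "exp (l * y) \<le> 1 + 2 * l * y" by simp
  moreover have "0 \<le> 800 * exp l * y ^ 4" using assms by simp
  ultimately show ?thesis by linarith
next
  case False
  then have y: "0 < y" "0 < l" using assms by (cases "y = 0"; cases "l = 0"; simp)+
  define \<rho> where "\<rho> = 1 / y"
  have \<rho>: "1 \<le> \<rho>" "0 < \<rho>" "\<rho> * y = 1" using y assms by (simp_all add: \<rho>_def)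
  have "\<rho> / 4 \<le> exp (\<rho> / 4)" using exp_ge_add_one_self[of "\<rho> / 4"] by linarith
  then have "(\<rho> / 4) ^ 4 \<le> exp (\<rho> / 4) ^ 4" using \<rho> by (intro power_mono) auto
  also have "\<dots> = exp \<rho>" by (simp flip: exp_of_nat_mult)
  finally have 1: "\<rho> ^ 4 \<le> 256 * exp \<rho>" by (simp add: power_divide)
  have "\<rho> - 1 \<le> (\<rho> - 1) * (l * y)" using \<rho> False mult_left_mono[of 1 "l * y" "\<rho> - 1"] by simp
  also have "\<dots> = l * (\<rho> * y) - l * y" by (simp add: algebra_simps)
  finally have 2: "\<rho> \<le> 1 + (l - l * y)" using \<rho> by simp
  have "\<rho> ^ 4 \<le> 256 * exp (1 + (l - l * y))" using 1 2 by (meson exp_le_cancel_iff mult_left_mono order.trans zero_le_numeral)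
  also have "\<dots> = 256 * exp 1 * exp (l - l * y)" by (simp add: exp_add)
  also have "\<dots> \<le> 800 * exp (l - l * y)" using exp_le by (intro mult_right_mono) auto
  finally have "\<rho> ^ 4 * y ^ 4 * exp (l * y) \<le> 800 * exp (l - l * y) * y ^ 4 * exp (l * y)"
    using y by (intro mult_right_mono) auto
  also have "\<dots> = 800 * exp l * y ^ 4" by (simp add: exp_diff)
  finally have "exp (l * y) \<le> 800 * exp l * y ^ 4" using \<rho> by (simp flip: power_mult_distrib)
  moreover have "0 \<le> 2 * l * y" using y by simp
  ultimately show ?thesis by linarith
qed

lemma ennreal_le_suminf: "f j \<le> (\<Sum>j. f j)" for f :: "nat \<Rightarrow> ennreal"
  using sum_le_suminf[of f "{j}"] by simp

context sequence_space
begin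

lemma chernoff_iid:
  fixes h :: "'a \<Rightarrow> real"
  assumes [measurable]: "h \<in> borel_measurable M" and h: "\<And>z. 0 \<le> h z" "\<And>z. h z \<le> 1"
    and l: "0 \<le> l" and e1: "real n * (\<integral>z. h z \<partial>M) \<le> e1" and e4: "real n * (\<integral>z. h z ^ 4 \<partial>M) \<le> e4"
  shows "\<P>(\<omega> in S. C < (\<Sum>i<n. h (\<omega> i))) \<le> exp (- l * C + 2 * l * e1 + 800 * exp l * e4)"
proof -
  let ?E = "2 * l * (\<integral>z. h z \<partial>M) + 800 * exp l * (\<integral>z. h z ^ 4 \<partial>M)"
  have [simp]: "integrable M h" using h by (intro M.integrable_const_bound[of _ 1]) auto
  have [simp]: "integrable M (\<lambda>z. h z ^ 4)"
    using h by (intro M.integrable_const_bound[of _ 1]) (auto simp: power_le_one)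
  have E0: "0 \<le> ?E" using l h by (intro add_nonneg_nonneg mult_nonneg_nonneg integral_nonneg) auto
  have "(\<integral>\<^sup>+z. ennreal (exp (l * h z)) \<partial>M)
      \<le> (\<integral>\<^sup>+z. ennreal (1 + 2 * l * h z + 800 * exp l * h z ^ 4) \<partial>M)"
    using h l by (intro nn_integral_mono ennreal_leI exp_mult_le_quartic) auto
  also have "\<dots> = ennreal (\<integral>z. 1 + 2 * l * h z + 800 * exp l * h z ^ 4 \<partial>M)"
    using h l by (intro nn_integral_eq_integral) auto
  also have "(\<integral>z. 1 + 2 * l * h z + 800 * exp l * h z ^ 4 \<partial>M) = 1 + ?E"
    by (simp add: M.prob_space)
  also have "ennreal (1 + ?E) \<le> ennreal (exp ?E)" by (intro ennreal_leI exp_ge_add_one_self)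
  finally have 1: "(\<integral>\<^sup>+z. ennreal (exp (l * h z)) \<partial>M) \<le> ennreal (exp ?E)" .
  have "emeasure S {\<omega>\<in>space S. C < (\<Sum>i<n. h (\<omega> i))}
      \<le> (\<integral>\<^sup>+\<omega>. ennreal (exp (- l * C)) * (\<Prod>i<n. ennreal (exp (l * h (\<omega> i)))) \<partial>S)"
  proof (subst nn_integral_indicator[symmetric])
    show "(\<integral>\<^sup>+\<omega>. indicator {\<omega>\<in>space S. C < (\<Sum>i<n. h (\<omega> i))} \<omega> \<partial>S)
      \<le> (\<integral>\<^sup>+\<omega>. ennreal (exp (- l * C)) * (\<Prod>i<n. ennreal (exp (l * h (\<omega> i)))) \<partial>S)"
    proof (rule nn_integral_mono)
      fix \<omega>
      have "ennreal (exp (- l * C)) * (\<Prod>i<n. ennreal (exp (l * h (\<omega> i))))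
         = ennreal (exp (l * ((\<Sum>i<n. h (\<omega> i)) - C)))"
        by (simp add: prod_ennreal exp_sum[symmetric] sum_distrib_left[symmetric] right_diff_distrib
              flip: ennreal_mult exp_add)
      moreover have "1 \<le> exp (l * ((\<Sum>i<n. h (\<omega> i)) - C))" if "C < (\<Sum>i<n. h (\<omega> i))"
        using l that by simp
      ultimately show "indicator {\<omega>\<in>space S. C < (\<Sum>i<n. h (\<omega> i))} \<omega>
          \<le> ennreal (exp (- l * C)) * (\<Prod>i<n. ennreal (exp (l * h (\<omega> i))))"
        by (auto simp: indicator_def)
    qed
  qed measurable
  also have "\<dots> = ennreal (exp (- l * C)) * (\<integral>\<^sup>+z. ennreal (exp (l * h z)) \<partial>M) ^ n"
    by (simp add: nn_integral_cmult nn_integral_prod_iid[of "\<lambda>z. ennreal (exp (l * h z))" n])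
  also have "\<dots> \<le> ennreal (exp (- l * C)) * ennreal (exp ?E) ^ n"
    by (intro mult_left_mono power_mono 1) auto
  also have "\<dots> = ennreal (exp (- l * C + n * ?E))"
    by (simp only: ennreal_power exp_ge_zero exp_of_nat_mult[symmetric] exp_add[symmetric]
          ennreal_mult[symmetric])
  finally have "\<P>(\<omega> in S. C < (\<Sum>i<n. h (\<omega> i))) \<le> exp (- l * C + n * ?E)"
    by (simp add: P.emeasure_eq_measure)
  also have "n * ?E = 2 * l * (n * (\<integral>z. h z \<partial>M)) + 800 * exp l * (n * (\<integral>z. h z ^ 4 \<partial>M))"
    by (simp add: algebra_simps)
  also have "exp (- l * C + (2 * l * (n * (\<integral>z. h z \<partial>M)) + 800 * exp l * (n * (\<integral>z. h z ^ 4 \<partial>M))))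
      \<le> exp (- l * C + 2 * l * e1 + 800 * exp l * e4)"
    unfolding exp_le_cancel_iff add.assoc using l by (intro add_mono order.refl mult_left_mono e1 e4) auto
  finally show ?thesis .
qed

text \<open>To be applied with \<open>Y\<close> the norm and \<open>h\<close> its part above the
  truncation level. Either some \<open>Y\<close> exceeds \<open>a\<close>, which the fourth moment
  makes rare, or capping \<open>h / a\<close> at 1 changes nothing and Chernoff's bound applies. The
  result is linear in \<open>\<beta>\<close>, so summable moments give summable probabilities;
  \<open>\<kappa>\<close> keeps the exponent finite when \<open>\<beta> = 0\<close>, and will be 1 /
  k^2.\<close>

lemma prob_sum_excess:
  fixes Y h :: "'a \<Rightarrow> real"
  assumes [measurable]: "Y \<in> borel_measurable M" "h \<in> borel_measurable M"
    and h: "\<And>z. 0 \<le> h z" "\<And>z. h z \<le> Y z"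
    and a: "0 < a" and \<kappa>: "0 < \<kappa>" "\<kappa> \<le> 1"
    and e1: "real n * (\<integral>z. min (h z / a) 1 \<partial>M) \<le> e1"
    and \<beta>: "\<beta> = real n * (\<integral>z. min (Y z / a) 1 ^ 4 \<partial>M)"
  shows "\<P>(\<omega> in S. (2 * e1 + 1) * a < (\<Sum>i<n. h (\<omega> i))) \<le> \<beta> + exp 800 * (\<beta> + \<kappa>)"
proof -
  have Y0: "0 \<le> Y z" for z using h[of z] by linarith
  have [simp]: "integrable M (\<lambda>z. min (Y z / a) 1 ^ 4)"
    using Y0 a by (intro M.integrable_const_bound[of _ 1]) (auto simp: power_le_one)
  have [simp]: "integrable M (\<lambda>z. min (h z / a) 1 ^ 4)"
    using h a by (intro M.integrable_const_bound[of _ 1]) (auto simp: power_le_one)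
  have \<beta>0: "0 \<le> \<beta>" unfolding \<beta> using Y0 a by (intro mult_nonneg_nonneg integral_nonneg) auto
  have "(\<integral>z. min (h z / a) 1 ^ 4 \<partial>M) \<le> (\<integral>z. min (Y z / a) 1 ^ 4 \<partial>M)"
    using h a by (intro integral_mono power_mono min.mono divide_right_mono) auto
  then have e4: "real n * (\<integral>z. min (h z / a) 1 ^ 4 \<partial>M) \<le> \<beta>"
    unfolding \<beta> by (intro mult_left_mono) auto
  have big: "\<P>(\<omega> in S. \<exists>i<n. a < Y (\<omega> i)) \<le> \<beta>"
  proof -
    have "\<P>(z in M. a < Y z) = (\<integral>z. indicator {z\<in>space M. a < Y z} z \<partial>M)" by simp
    also have "\<dots> \<le> (\<integral>z. min (Y z / a) 1 ^ 4 \<partial>M)"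
    proof (rule integral_mono)
      show "integrable M (indicator {z\<in>space M. a < Y z} :: _ \<Rightarrow> real)"
        by (intro integrable_real_indicator) (auto simp: M.emeasure_eq_measure)
      show "indicator {z\<in>space M. a < Y z} z \<le> min (Y z / a) 1 ^ 4" for z
        using Y0[of z] a by (auto simp: indicator_def min_def field_simps)
    qed simp
    finally have p: "\<P>(z in M. a < Y z) \<le> (\<integral>z. min (Y z / a) 1 ^ 4 \<partial>M)" .
    have "\<P>(\<omega> in S. \<exists>i<n. a < Y (\<omega> i)) = 1 - \<P>(\<omega> in S. \<forall>i<n. \<not> a < Y (\<omega> i))"
      by (subst P.prob_neg[symmetric]) auto
    also have "\<dots> = 1 - (1 - \<P>(z in M. a < Y z)) ^ n"
      by (subst prob_all_lt) (auto simp: M.prob_neg)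
    also have "\<dots> \<le> n * \<P>(z in M. a < Y z)"
      using Bernoulli_inequality[of "- \<P>(z in M. a < Y z)" n] by simp
    also have "\<dots> \<le> \<beta>" unfolding \<beta> by (intro mult_left_mono p) auto
    finally show ?thesis .
  qed
  have small: "\<P>(\<omega> in S. 2 * e1 + 1 < (\<Sum>i<n. min (h (\<omega> i) / a) 1)) \<le> exp 800 * (\<beta> + \<kappa>)"
  \<comment> \<open>Above 1 the bound is trivial; up to 1 the exponent \<open>l\<close> is
    nonnegative.\<close>
  proof (cases "\<beta> + \<kappa> \<le> 1")
    case False
    have "\<P>(\<omega> in S. 2 * e1 + 1 < (\<Sum>i<n. min (h (\<omega> i) / a) 1)) \<le> 1 * 1" by simp
    also have "\<dots> \<le> exp 800 * (\<beta> + \<kappa>)" using False by (intro mult_mono) auto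
    finally show ?thesis .
  next
    case True
    \<comment> \<open>the exponent of Chernoff's bound adapted to the size of the fourth moment\<close>
    define l where "l = - ln (\<beta> + \<kappa>)"
    have l: "0 \<le> l" "exp l = 1 / (\<beta> + \<kappa>)"
      using True \<beta>0 \<kappa> by (auto simp: l_def exp_minus inverse_eq_divide)
    have "exp l * \<beta> \<le> 1" using \<beta>0 \<kappa> by (simp add: l)
    have "\<P>(\<omega> in S. 2 * e1 + 1 < (\<Sum>i<n. min (h (\<omega> i) / a) 1))
      \<le> exp (- l * (2 * e1 + 1) + 2 * l * e1 + 800 * exp l * \<beta>)"
      using h a l by (intro chernoff_iid e1 e4) auto
    also have "\<dots> \<le> exp (800 + ln (\<beta> + \<kappa>))"
      using \<open>exp l * \<beta> \<le> 1\<close> by (simp add: l_def algebra_simps)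
    also have "\<dots> = exp 800 * (\<beta> + \<kappa>)" using \<beta>0 \<kappa> by (simp add: exp_add)
    finally show ?thesis .
  qed
  have "\<P>(\<omega> in S. (2 * e1 + 1) * a < (\<Sum>i<n. h (\<omega> i)))
    \<le> P.prob ({\<omega>\<in>space S. \<exists>i<n. a < Y (\<omega> i)} \<union>
              {\<omega>\<in>space S. 2 * e1 + 1 < (\<Sum>i<n. min (h (\<omega> i) / a) 1)})"
  proof (intro P.finite_measure_mono subsetI)
    fix \<omega> assume \<omega>: "\<omega> \<in> {\<omega>\<in>space S. (2 * e1 + 1) * a < (\<Sum>i<n. h (\<omega> i))}"
    show "\<omega> \<in> {\<omega>\<in>space S. \<exists>i<n. a < Y (\<omega> i)} \<union>
              {\<omega>\<in>space S. 2 * e1 + 1 < (\<Sum>i<n. min (h (\<omega> i) / a) 1)}"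
    proof (cases "\<exists>i<n. a < Y (\<omega> i)")
      case False
      have "h (\<omega> i) / a \<le> 1" if "i < n" for i
      proof -
        have "Y (\<omega> i) \<le> a" using False that by (meson not_less)
        with h(2)[of "\<omega> i"] a show ?thesis by simp
      qed
      then have "(\<Sum>i<n. min (h (\<omega> i) / a) 1) = (\<Sum>i<n. h (\<omega> i) / a)"
        by (intro sum.cong) auto
      also have "\<dots> = (\<Sum>i<n. h (\<omega> i)) / a" by (simp add: sum_divide_distrib)
      finally have "2 * e1 + 1 < (\<Sum>i<n. min (h (\<omega> i) / a) 1)"
        using \<omega> a by (simp add: pos_less_divide_eq)
      then show ?thesis using \<omega> by simp
    qed (use \<omega> in auto)
  qed measurable
  also have "\<dots> \<le> \<P>(\<omega> in S. \<exists>i<n. a < Y (\<omega> i)) + \<P>(\<omega> in S. 2 * e1 + 1 < (\<Sum>i<n. min (h (\<omega> i) / a) 1))"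
    by (intro measure_Un_le) measurable
  also have "\<dots> \<le> \<beta> + exp 800 * (\<beta> + \<kappa>)" by (intro add_mono big small)
  finally show ?thesis .
qed

text \<open>Cut the range of the norm into shells from 2^j c to 2^(j + 1) c. The weak second moment
  gives a shell probability of at most 1 / (r 4^j), so the contributions to the mean decay like
  2^(-j).\<close>

lemma nn_integral_excess_le:
  assumes bd [simp]: "pointwise_bounded g" and gm [measurable]: "\<And>j. g j \<in> borel_measurable M"
    and A: "0 < A" and tight: "\<And>n. 1 \<le> n \<Longrightarrow> \<P>(\<omega> in S. A * sqrt (real n) < supsum g n \<omega>) \<le> 1 / 8"
    and r: "0 < r"
  shows "(\<integral>\<^sup>+z. ennreal (excess (4 * (A * sqrt (real r))) g z) \<partial>M) \<le> ennreal (16 * A / sqrt (real r))"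
proof -
  have [measurable]: "sup_norm g \<in> borel_measurable M" by (intro sup_norm_measurable bd gm)
  define c where "c = 4 * (A * sqrt (real r))"
  have c: "0 < c" using A r by (simp add: c_def)
  have "(\<integral>\<^sup>+z. ennreal (excess c g z) \<partial>M)
     \<le> (\<integral>\<^sup>+z. (\<Sum>j. ennreal (2 * 2 ^ j * c) * indicator {z\<in>space M. 2 ^ j * c < sup_norm g z} z) \<partial>M)"
  proof (rule nn_integral_mono)
    fix z assume z: "z \<in> space M"
    show "ennreal (excess c g z)
      \<le> (\<Sum>j. ennreal (2 * 2 ^ j * c) * indicator {z\<in>space M. 2 ^ j * c < sup_norm g z} z)"
    proof (cases "sup_norm g z \<le> c")
      case False
      obtain k where "sup_norm g z / c < 2 ^ k" using real_arch_pow[of 2 "sup_norm g z / c"] by auto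
      then have k: "sup_norm g z \<le> 2 ^ k * c" using c by (simp add: field_simps)
      define m where "m = (LEAST k. sup_norm g z \<le> 2 ^ k * c)"
      have m: "sup_norm g z \<le> 2 ^ m * c" unfolding m_def using k by (rule LeastI)
      have "m \<noteq> 0" using False m by (intro notI) simp
      then obtain j where j: "m = Suc j" by (cases m) auto
      have "\<not> sup_norm g z \<le> 2 ^ j * c"
        using not_less_Least[of j "\<lambda>k. sup_norm g z \<le> 2 ^ k * c"] j by (simp add: m_def)
      then have "ennreal (excess c g z) \<le> ennreal (2 * 2 ^ j * c) * indicator {z\<in>space M. 2 ^ j * c < sup_norm g z} z"
        using m z False by (simp add: excess_def j ennreal_leI)
      also have "\<dots> \<le> (\<Sum>j. ennreal (2 * 2 ^ j * c) * indicator {z\<in>space M. 2 ^ j * c < sup_norm g z} z)"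
        by (rule ennreal_le_suminf)
      finally show ?thesis .
    qed (simp add: excess_def)
  qed
  also have "\<dots> = (\<Sum>j. ennreal (2 * 2 ^ j * c) * emeasure M {z\<in>space M. 2 ^ j * c < sup_norm g z})"
    by (subst nn_integral_suminf) (auto simp: nn_integral_cmult)
  also have "\<dots> \<le> (\<Sum>j. ennreal (8 * A / sqrt (real r) * (1 / 2) ^ j))"
  proof (intro suminf_le summableI)
    fix j :: nat
    \<comment> \<open>The tail bound is used for blocks of length \<open>r * 4 ^ j\<close>, whose
      square root is 2^j times that of \<open>r\<close>.\<close>
    have "sqrt (4 ^ j) = 2 ^ j" by (simp add: real_sqrt_power)
    then have s: "sqrt (real (r * 4 ^ j)) = 2 ^ j * sqrt (real r)" by (simp add: real_sqrt_mult)
    have "\<P>(z in M. 4 * (A * sqrt (real (r * 4 ^ j))) < sup_norm g z) \<le> 1 / real (r * 4 ^ j)"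
      using r by (intro prob_sup_norm_gt bd gm A tight) auto
    then have "\<P>(z in M. 2 ^ j * c < sup_norm g z) \<le> 1 / (real r * 4 ^ j)"
      unfolding s by (simp add: c_def mult_ac)
    then have "2 * 2 ^ j * c * \<P>(z in M. 2 ^ j * c < sup_norm g z) \<le> 2 * 2 ^ j * c * (1 / (real r * 4 ^ j))"
      using c by (intro mult_left_mono) auto
    also have "\<dots> = 8 * A * (sqrt (real r) / real r) * (2 ^ j / 4 ^ j)" by (simp add: c_def)
    also have "sqrt (real r) / real r = 1 / sqrt (real r)" using r by (simp add: real_div_sqrt field_simps)
    also have "(2 ^ j / 4 ^ j :: real) = (1/2) ^ j" by (simp flip: power_divide)
    finally have "2 * 2 ^ j * c * \<P>(z in M. 2 ^ j * c < sup_norm g z) \<le> 8 * A / sqrt (real r) * (1 / 2) ^ j" by simp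
    then show "ennreal (2 * 2 ^ j * c) * emeasure M {z\<in>space M. 2 ^ j * c < sup_norm g z}
       \<le> ennreal (8 * A / sqrt (real r) * (1 / 2) ^ j)"
      using c by (simp add: M.emeasure_eq_measure ennreal_leI flip: ennreal_mult)
  qed
  also have "\<dots> = ennreal (\<Sum>j. 8 * A / sqrt (real r) * (1 / 2) ^ j)"
    using A by (intro suminf_ennreal2 summable_mult summable_geometric) auto
  also have "(\<Sum>j. 8 * A / sqrt (real r) * (1 / 2 :: real) ^ j) = 16 * A / sqrt (real r)"
    by (subst suminf_mult) (auto simp: suminf_geometric)
  finally show ?thesis by (simp add: c_def)
qed

end

section \<open>The moment condition\<close>

lemma sum_dyadic_min_le:
  fixes v :: real
  assumes "0 \<le> v"
  shows "(\<Sum>k<n. min (2 ^ k) (v\<^sup>2 / 2 ^ k)) \<le> 6 * v"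
proof (cases "v = 0")
  case False
  then have v: "0 < v" using assms by simp
  \<comment> \<open>the increments of H are comparable to the summands, so the sum telescopes\<close>
  define H where "H k = 2 ^ k * v / (v + 2 ^ k)" for k :: nat
  have step: "min (2 ^ k) (v\<^sup>2 / 2 ^ k) \<le> 6 * (H (Suc k) - H k)" for k
  proof -
    define x :: real where "x = 2 ^ k"
    have x: "0 < x" by (simp add: x_def)
    have "H (Suc k) - H k = x * v\<^sup>2 / ((v + 2 * x) * (v + x))"
      using x v by (simp add: H_def x_def[symmetric] field_simps power2_eq_square)
    \<comment> \<open>The 6 is 3 * 2: v + 2 x is at most three times, and v + x at most twice, the
      larger of x and v.\<close>
    moreover have "min x (v\<^sup>2 / x) \<le> 6 * (x * v\<^sup>2 / ((v + 2 * x) * (v + x)))"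
    proof (cases "x \<le> v")
      case True
      have "(v + 2 * x) * (v + x) \<le> (3 * v) * (2 * v)" using True x v by (intro mult_mono) auto
      then have "x * ((v + 2 * x) * (v + x)) \<le> x * (6 * v\<^sup>2)"
        using x by (intro mult_left_mono) (auto simp: power2_eq_square)
      then have "x \<le> 6 * (x * v\<^sup>2 / ((v + 2 * x) * (v + x)))"
        using x v by (simp add: pos_le_divide_eq mult_ac)
      then show ?thesis by simp
    next
      case False
      have "(v + 2 * x) * (v + x) \<le> (3 * x) * (2 * x)" using False x v by (intro mult_mono) auto
      then have "v\<^sup>2 * ((v + 2 * x) * (v + x)) \<le> v\<^sup>2 * (6 * x\<^sup>2)"
        using v by (intro mult_left_mono) (auto simp: power2_eq_square)
      then have "v\<^sup>2 / x \<le> 6 * (x * v\<^sup>2 / ((v + 2 * x) * (v + x)))"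
        using x v by (simp add: divide_le_eq pos_le_divide_eq power2_eq_square mult_ac)
      then show ?thesis by simp
    qed
    ultimately show ?thesis by (simp add: x_def)
  qed
  have "(\<Sum>k<n. min (2 ^ k) (v\<^sup>2 / 2 ^ k)) \<le> (\<Sum>k<n. 6 * (H (Suc k) - H k))"
    by (intro sum_mono step)
  also have "\<dots> = 6 * (H n - H 0)" by (simp only: sum_distrib_left[symmetric] sum_lessThan_telescope)
  also have "\<dots> \<le> 6 * v"
  proof -
    have "0 \<le> H 0" using v by (simp add: H_def)
    moreover have "2 ^ n * v \<le> v * (v + 2 ^ n)" using v by (simp add: algebra_simps)
    then have "H n \<le> v" using v by (simp add: H_def divide_le_eq add_pos_pos)
    ultimately show ?thesis by simp
  qed
  finally show ?thesis .
qed simp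

text \<open>The normalisation sqrt(n log log n) at n = 2^k, with ln k in place of log log n. From k
  = 3 on the logarithm is at least 1, hence the shift by 3 in the series below.\<close>

definition lil_scale :: "nat \<Rightarrow> real" where
  "lil_scale k = sqrt (2 ^ k * ln (real k))"

lemma ln_ge_1: "3 \<le> k \<Longrightarrow> 1 \<le> ln (real k)"
  using exp_le ln_ge_iff[of "real k" 1] by simp

lemma lil_scale_pos: "3 \<le> k \<Longrightarrow> 0 < lil_scale k"
  using ln_ge_1[of k] by (simp add: lil_scale_def)

lemma LogLog_ge_1: "1 \<le> Log (Log x)"
  unfolding Log_def[of "Log x"] by (subst ln_ge_iff) (auto simp: less_max_iff_disj)

lemma varphi_nonneg: "0 \<le> varphi x"
  using LogLog_ge_1[of x] by (simp add: varphi_def)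

text \<open>Unless the iterated logarithm is at its floor, x <= \<open>varphi x\<close> < 2^k <=
  exp(k), so \<open>Log x\<close> is at most k. At scale k, ln k may therefore be exchanged for
  \<open>Log (Log x)\<close>, which produces \<open>varphi\<close> from a power of x.\<close>

lemma LogLog_le_ln:
  assumes k: "3 \<le> k" and x: "0 \<le> x" "varphi x < 2 ^ k"
  shows "Log (Log x) \<le> ln (real k)"
proof -
  have e: "exp 1 \<le> real k" using exp_le k by simp
  have "Log x \<le> real k"
  proof (cases "Log x \<le> exp 1")
    case False
    then have xe: "exp 1 < x" by (auto simp: Log_def max_def split: if_splits)
    have Lx: "Log x = ln x" using xe by (simp add: Log_def max_def)
    have LL: "Log (Log x) = ln (Log x)" using False by (simp add: Log_def[of "Log x"] max_def)
    have "0 < x" using xe by (meson exp_gt_zero less_trans)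
    have "0 < Log x" using False by (meson exp_gt_zero less_trans not_le)
    have "Log (Log x) \<le> x"
      using ln_le_minus_one[OF \<open>0 < Log x\<close>] ln_le_minus_one[OF \<open>0 < x\<close>] unfolding LL by (simp add: Lx)
    moreover have "0 < Log (Log x)" using LogLog_ge_1[of x] by linarith
    ultimately have "x \<le> varphi x"
      using \<open>0 < x\<close> by (simp add: varphi_def pos_le_divide_eq power2_eq_square)
    also have "\<dots> < 2 ^ k" by fact
    also have "\<dots> \<le> exp 1 ^ k" using exp_ge_add_one_self[of 1] by (intro power_mono) auto
    also have "\<dots> = exp (real k)" by (simp flip: exp_of_nat_mult)
    finally have "x < exp (real k)" .
    then have "ln x < ln (exp (real k))" using \<open>0 < x\<close> by (subst ln_less_cancel_iff) auto
    then show ?thesis by (simp add: Lx)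
  qed (use e in simp)
  then have "max (Log x) (exp 1) \<le> real k" using e by simp
  then show ?thesis unfolding Log_def[of "Log x"]
    using k by (subst ln_le_cancel_iff) (auto simp: less_max_iff_disj)
qed

text \<open>If \<open>varphi x\<close> is below 2^k, exchanging ln k for \<open>Log (Log x)\<close>
  turns the fourth power of x into the square of \<open>varphi x\<close>; if not, the cap at 1
  already gives the bound.\<close>

lemma dyadic_moment_term_le:
  assumes k: "3 \<le> k" and x: "0 \<le> x"
  shows "2 ^ k * min (x / lil_scale k) 1 ^ 4 \<le> min (2 ^ k) ((varphi x)\<^sup>2 / 2 ^ k)"
proof -
  have a: "0 < lil_scale k" by (rule lil_scale_pos[OF k])
  have m: "0 \<le> min (x / lil_scale k) 1" using x a by simp
  have "2 ^ k * min (x / lil_scale k) 1 ^ 4 \<le> 2 ^ k * 1"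
    using m by (intro mult_left_mono power_le_one) auto
  moreover have "2 ^ k * min (x / lil_scale k) 1 ^ 4 \<le> (varphi x)\<^sup>2 / 2 ^ k"
  proof (cases "varphi x < 2 ^ k")
    case False
    have "2 ^ k * min (x / lil_scale k) 1 ^ 4 \<le> 2 ^ k * 1"
      using m by (intro mult_left_mono power_le_one) auto
    also have "\<dots> = (2 ^ k)\<^sup>2 / 2 ^ k" by (simp add: power2_eq_square)
    also have "\<dots> \<le> (varphi x)\<^sup>2 / 2 ^ k" using False by (intro divide_right_mono power_mono) auto
    finally show ?thesis .
  next
    case True
    have W: "1 \<le> Log (Log x)" "Log (Log x) \<le> ln (real k)"
      using LogLog_ge_1 LogLog_le_ln[OF k x True] by auto
    have "2 ^ k * min (x / lil_scale k) 1 ^ 4 \<le> 2 ^ k * (x / lil_scale k) ^ 4"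
      using m by (intro mult_left_mono power_mono) auto
    also have "lil_scale k ^ 4 = (2 ^ k * ln (real k))\<^sup>2"
      using ln_ge_1[OF k] by (simp add: lil_scale_def power4_eq_xxxx power2_eq_square)
    then have "2 ^ k * (x / lil_scale k) ^ 4 = x ^ 4 / (ln (real k))\<^sup>2 / 2 ^ k"
      by (simp add: power_divide power_mult_distrib) (simp add: power2_eq_square)
    also have "\<dots> \<le> x ^ 4 / (Log (Log x))\<^sup>2 / 2 ^ k"
      using W x by (intro divide_right_mono divide_left_mono power_mono mult_pos_pos zero_less_power) auto
    also have "\<dots> = (varphi x)\<^sup>2 / 2 ^ k" by (simp add: varphi_def power_divide flip: power_mult)
    finally show ?thesis .
  qed
  ultimately show ?thesis by simp
qed

lemma suminf_dyadic_moment_le: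
  assumes "0 \<le> x"
  shows "(\<Sum>k. ennreal (2 ^ (k + 3) * min (x / lil_scale (k + 3)) 1 ^ 4)) \<le> ennreal (6 * varphi x)"
proof (rule suminf_le_const[OF summableI])
  fix n
  have "(\<Sum>k<n. 2 ^ (k + 3) * min (x / lil_scale (k + 3)) 1 ^ 4)
      \<le> (\<Sum>k<n. min (2 ^ (k + 3)) ((varphi x)\<^sup>2 / 2 ^ (k + 3)))"
    using assms by (intro sum_mono dyadic_moment_term_le) auto
  also have "\<dots> = (\<Sum>k=3..<n + 3. min (2 ^ k) ((varphi x)\<^sup>2 / 2 ^ k))"
    using sum.shift_bounds_nat_ivl[of "\<lambda>k. min (2 ^ k) ((varphi x)\<^sup>2 / 2 ^ k)" 0 3 n] 
    by (simp add: atLeast0LessThan)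
  also have "\<dots> \<le> (\<Sum>k<n + 3. min (2 ^ k) ((varphi x)\<^sup>2 / 2 ^ k))"
    by (intro sum_mono2) auto
  also have "\<dots> \<le> 6 * varphi x" by (intro sum_dyadic_min_le varphi_nonneg)
  finally show "(\<Sum>k<n. ennreal (2 ^ (k + 3) * min (x / lil_scale (k + 3)) 1 ^ 4)) \<le> ennreal (6 * varphi x)"
    using assms lil_scale_pos by (subst sum_ennreal) (auto intro!: mult_nonneg_nonneg ennreal_leI simp: less_imp_le)
qed

text \<open>Centring a function adds a constant to its envelope. The two parts are separated here,
  at the level of capped fourth powers; 16 is 2^4, since x + c is at most twice the larger.\<close>

lemma min_double_pow4_le:
  fixes x c a :: real
  assumes "0 \<le> x" "0 \<le> c" "0 < a" "y \<le> x + c" "0 \<le> y"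
  shows "min (y / a) 1 ^ 4 \<le> 16 * (min (x / a) 1 ^ 4 + min (c / a) 1 ^ 4)"
proof -
  define m where "m = max x c"
  have m: "0 \<le> m" "y \<le> 2 * m" using assms by (auto simp: m_def)
  have "min (y / a) 1 \<le> 2 * (m / a)" "min (y / a) 1 \<le> 2"
    using divide_right_mono[OF m(2), of a] assms by (simp_all add: min_le_iff_disj)
  then have "min (y / a) 1 \<le> 2 * min (m / a) 1" by linarith
  then have "min (y / a) 1 ^ 4 \<le> (2 * min (m / a) 1) ^ 4"
    using assms by (intro power_mono) auto
  also have "\<dots> = 16 * min (m / a) 1 ^ 4" by (simp add: power_mult_distrib)
  also have "min (m / a) 1 ^ 4 \<le> min (x / a) 1 ^ 4 + min (c / a) 1 ^ 4"
    using assms by (auto simp: m_def max_def)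
  finally show ?thesis by simp
qed

lemma (in prob_space) summable_dyadic_moment:
  fixes Y F :: "'a \<Rightarrow> real"
  assumes [measurable]: "Y \<in> borel_measurable M" "F \<in> borel_measurable M"
    and Y: "\<And>z. 0 \<le> Y z" "\<And>z. Y z \<le> F z + c" and F: "\<And>z. 0 \<le> F z" and c: "0 \<le> c"
    and phi: "integrable M (\<lambda>z. varphi (F z))"
  shows "summable (\<lambda>k. 2 ^ (k + 3) * (\<integral>z. min (Y z / lil_scale (k + 3)) 1 ^ 4 \<partial>M))"
proof (rule summable_suminf_not_top)
  let ?a = "\<lambda>k. lil_scale (k + 3)"
  let ?t = "\<lambda>x k. 2 ^ (k + 3) * min (x / ?a k) 1 ^ 4 :: real"
  have a: "0 < ?a k" for k by (rule lil_scale_pos) simp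
  have ia: "integrable M (\<lambda>z. min (Y z / ?a k) 1 ^ 4)" for k
    using Y(1) less_imp_le[OF a] by (intro integrable_const_bound[of _ 1]) (auto simp: power_le_one)
  show "0 \<le> 2 ^ (k + 3) * (\<integral>z. min (Y z / ?a k) 1 ^ 4 \<partial>M)" for k
    using Y(1) less_imp_le[OF a] by (intro mult_nonneg_nonneg integral_nonneg) auto
  have t0: "0 \<le> ?t x k" if "0 \<le> x" for x k
    using that less_imp_le[OF a] by (intro mult_nonneg_nonneg) auto
  have "(\<Sum>k. ennreal (2 ^ (k + 3) * (\<integral>z. min (Y z / ?a k) 1 ^ 4 \<partial>M)))
      = (\<Sum>k. \<integral>\<^sup>+z. ennreal (?t (Y z) k) \<partial>M)"
  proof (intro suminf_cong)
    fix k
    have "(\<integral>\<^sup>+z. ennreal (?t (Y z) k) \<partial>M) = ennreal (\<integral>z. ?t (Y z) k \<partial>M)"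
      using ia t0 Y by (intro nn_integral_eq_integral integrable_mult_right AE_I2) auto
    then show "ennreal (2 ^ (k + 3) * (\<integral>z. min (Y z / ?a k) 1 ^ 4 \<partial>M)) = (\<integral>\<^sup>+z. ennreal (?t (Y z) k) \<partial>M)"
      by simp
  qed
  also have "\<dots> = (\<integral>\<^sup>+z. (\<Sum>k. ennreal (?t (Y z) k)) \<partial>M)"
    by (intro nn_integral_suminf[symmetric]) measurable
  also have "\<dots> \<le> (\<integral>\<^sup>+z. ennreal (96 * (varphi (F z) + varphi c)) \<partial>M)"
  proof (rule nn_integral_mono)
    fix z
    have "(\<Sum>k. ennreal (?t (Y z) k)) \<le> (\<Sum>k. ennreal 16 * (ennreal (?t (F z) k) + ennreal (?t c k)))"
    proof (intro suminf_le summableI)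
      fix k
      have "?t (Y z) k \<le> 2 ^ (k + 3) * (16 * (min (F z / ?a k) 1 ^ 4 + min (c / ?a k) 1 ^ 4))"
        by (intro mult_left_mono min_double_pow4_le F c a Y) auto
      also have "\<dots> = 16 * (?t (F z) k + ?t c k)" by (simp add: algebra_simps)
      finally have "ennreal (?t (Y z) k) \<le> ennreal (16 * (?t (F z) k + ?t c k))" by (rule ennreal_leI)
      also have "\<dots> = ennreal 16 * (ennreal (?t (F z) k) + ennreal (?t c k))"
        using t0[OF F[of z], of k] t0[OF c, of k]
        by (subst ennreal_mult) (auto simp: ennreal_plus simp del: ennreal_numeral)
      finally show "ennreal (?t (Y z) k) \<le> ennreal 16 * (ennreal (?t (F z) k) + ennreal (?t c k))" .
    qed
    also have "\<dots> = ennreal 16 * ((\<Sum>k. ennreal (?t (F z) k)) + (\<Sum>k. ennreal (?t c k)))"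
      by (subst ennreal_suminf_cmult, subst suminf_add) (auto intro: summableI)
    also have "\<dots> \<le> ennreal 16 * (ennreal (6 * varphi (F z)) + ennreal (6 * varphi c))"
      by (intro mult_left_mono add_mono suminf_dyadic_moment_le F c) auto
    also have "\<dots> = ennreal (16 * (6 * varphi (F z) + 6 * varphi c))"
      using varphi_nonneg[of "F z"] varphi_nonneg[of c]
      by (subst ennreal_mult) (auto simp: ennreal_plus simp del: ennreal_numeral)
    also have "16 * (6 * varphi (F z) + 6 * varphi c) = 96 * (varphi (F z) + varphi c)" by simp
    finally show "(\<Sum>k. ennreal (?t (Y z) k)) \<le> ennreal (96 * (varphi (F z) + varphi c))" .
  qed
  also have "\<dots> = ennreal (\<integral>z. 96 * (varphi (F z) + varphi c) \<partial>M)"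
    using phi varphi_nonneg by (intro nn_integral_eq_integral) auto
  also have "\<dots> < top" by simp
  finally show "(\<Sum>k. ennreal (2 ^ (k + 3) * (\<integral>z. min (Y z / ?a k) 1 ^ 4 \<partial>M))) \<noteq> top" by simp
qed

section \<open>The bounded law of the iterated logarithm\<close>

lemma (in sequence_space) bounded_lil_dyadic:
  assumes bd [simp]: "pointwise_bounded g" and gm [measurable]: "\<And>j. g j \<in> borel_measurable M"
    and A: "0 < A" and tight: "\<And>n. 1 \<le> n \<Longrightarrow> \<P>(\<omega> in S. A * sqrt (real n) < supsum g n \<omega>) \<le> 1 / 8"
    and moment: "summable (\<lambda>k. 2 ^ (k + 3) * (\<integral>z. min (sup_norm g z / lil_scale (k + 3)) 1 ^ 4 \<partial>M))"
  shows "AE \<omega> in S. \<forall>\<^sub>F k in sequentially. \<forall>n\<le>2 ^ k. supsum g n \<omega> \<le> (92 * A + 1) * lil_scale k"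
proof -
  note [measurable] = supsum_measurable[OF bd gm] sup_norm_measurable[OF bd gm] excess_measurable[OF bd gm]
    supsum_trunc_measurable[OF bd gm]
  \<comment> \<open>The block length n / m for n = 2^k and m = ln k, rounded up.\<close>
  define r where "r k = nat \<lceil>2 ^ k / ln (real k)\<rceil>" for k :: nat
  \<comment> \<open>With 6 m restarts the exponent in \<open>prob_max_trunc_passage\<close> is at
    most m - 3 m = -2 m, so the probability is at most 1 / k^2.\<close>
  define l where "l k = nat \<lceil>6 * ln (real k)\<rceil>" for k :: nat
  define b where "b k = 4 * (A * sqrt (real (r k)))" for k
  define \<beta> where "\<beta> k = real (2 ^ k) * (\<integral>z. min (sup_norm g z / lil_scale k) 1 ^ 4 \<partial>M)" for k :: nat
  define B1 where "B1 k = {\<omega>\<in>space S. \<exists>n\<le>2 ^ k. real (l k) * (6 * (A * sqrt (real (r k)))) < supsum (trunc (b k) g) n \<omega>}" for k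
  \<comment> \<open>The level of \<open>prob_sum_excess\<close> with 16 A as the bound on the
    normalised mean of the excess.\<close>
  define B2 where "B2 k = {\<omega>\<in>space S. (2 * (16 * A) + 1) * lil_scale k < (\<Sum>i<2 ^ k. excess (b k) g (\<omega> i))}" for k
  have [measurable]: "B1 k \<in> sets S" "B2 k \<in> sets S" for k unfolding B1_def B2_def by measurable
  have r: "0 < r k" "2 ^ k / ln (real k) \<le> real (r k)" "real (r k) \<le> 2 * (2 ^ k / ln (real k))" if k: "3 \<le> k" for k
  proof -
    have "1 \<le> ln (real k)" by (rule ln_ge_1[OF k])
    then have p: "0 < 2 ^ k / ln (real k)" by (intro divide_pos_pos) auto
    then show "0 < r k" by (simp add: r_def)
    show "2 ^ k / ln (real k) \<le> real (r k)" unfolding r_def by (rule real_nat_ceiling_ge)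
    have "ln (real k) \<le> real k" using ln_le_minus_one[of "real k"] k by simp
    also have "\<dots> \<le> 2 ^ k" using of_nat_less_two_power[of k, where 'a=real] by simp
    finally have "1 \<le> 2 ^ k / ln (real k)" using \<open>1 \<le> ln (real k)\<close> by simp
    moreover have "real (r k) \<le> 2 ^ k / ln (real k) + 1"
      using p by (simp add: r_def of_nat_nat ceiling_correct less_imp_le)
    ultimately show "real (r k) \<le> 2 * (2 ^ k / ln (real k))" by linarith
  qed
  have l: "6 * ln (real k) \<le> real (l k)" "real (l k) \<le> 7 * ln (real k)" if k: "3 \<le> k" for k
  proof -
    have 1: "1 \<le> ln (real k)" by (rule ln_ge_1[OF k])
    show "6 * ln (real k) \<le> real (l k)" unfolding l_def by (rule real_nat_ceiling_ge)
    have "real (l k) \<le> 6 * ln (real k) + 1"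
      using 1 of_int_ceiling_le_add_one[of "6 * ln (real k)"] by (simp add: l_def of_nat_nat)
    then show "real (l k) \<le> 7 * ln (real k)" using 1 by simp
  qed
  have p1: "P.prob (B1 k) \<le> 1 / real k ^ 2" if k: "3 \<le> k" for k
  proof -
    have 1: "1 \<le> ln (real k)" by (rule ln_ge_1[OF k])
    have "P.prob (B1 k) \<le> exp (real (2 ^ k) / real (r k) - real (l k) / 2)"
      unfolding B1_def b_def by (intro prob_max_trunc_passage bd gm A tight r k)
    also have "2 ^ k / real (r k) \<le> ln (real k)"
      using r[OF k] 1 by (simp add: field_simps)
    then have "exp (real (2 ^ k) / real (r k) - real (l k) / 2) \<le> exp (- 2 * ln (real k))"
      using l(1)[OF k] by simp
    also have "\<dots> = 1 / real k ^ 2" using k by (simp add: exp_minus exp_double divide_inverse)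
    finally show ?thesis .
  qed
  have p2: "P.prob (B2 k) \<le> \<beta> k + exp 800 * (\<beta> k + 1 / real k ^ 2)" if k: "3 \<le> k" for k
    unfolding B2_def
  proof (rule prob_sum_excess)
    let ?a = "lil_scale k"
    have 1: "1 \<le> ln (real k)" by (rule ln_ge_1[OF k])
    show a: "0 < ?a" by (rule lil_scale_pos[OF k])
    show ex: "0 \<le> excess (b k) g z" "excess (b k) g z \<le> sup_norm g z" for z
      using sup_norm_nonneg[OF bd, of z] by (auto simp: excess_def)
    show "0 < 1 / (real k)\<^sup>2" "1 / (real k)\<^sup>2 \<le> 1"
      using k one_le_power[of "real k" 2] by (auto simp: divide_le_eq)
    show "\<beta> k = real (2 ^ k) * (\<integral>z. min (sup_norm g z / ?a) 1 ^ 4 \<partial>M)" by (simp add: \<beta>_def)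
    have "ennreal (\<integral>z. min (excess (b k) g z / ?a) 1 \<partial>M) = (\<integral>\<^sup>+z. ennreal (min (excess (b k) g z / ?a) 1) \<partial>M)"
      using ex a by (intro nn_integral_eq_integral[symmetric] M.integrable_const_bound[of _ 1]) auto
    also have "\<dots> \<le> (\<integral>\<^sup>+z. ennreal (1 / ?a) * ennreal (excess (b k) g z) \<partial>M)"
      using ex a by (intro nn_integral_mono) (auto simp: ennreal_mult[symmetric] intro!: ennreal_leI)
    also have "\<dots> = ennreal (1 / ?a) * (\<integral>\<^sup>+z. ennreal (excess (b k) g z) \<partial>M)"
      by (intro nn_integral_cmult) measurable
    also have "\<dots> \<le> ennreal (1 / ?a) * ennreal (16 * A / sqrt (real (r k)))"
      unfolding b_def by (intro mult_left_mono nn_integral_excess_le bd gm A tight r k) auto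
    also have "\<dots> = ennreal (1 / ?a * (16 * A / sqrt (real (r k))))"
      using a A by (subst ennreal_mult) auto
    finally have "(\<integral>z. min (excess (b k) g z / ?a) 1 \<partial>M) \<le> 1 / ?a * (16 * A / sqrt (real (r k)))"
      using a A by (simp add: ennreal_le_iff)
    from mult_left_mono[OF this, of "2 ^ k"]
    have "real (2 ^ k) * (\<integral>z. min (excess (b k) g z / ?a) 1 \<partial>M)
        \<le> 2 ^ k * (1 / ?a * (16 * A / sqrt (real (r k))))" by simp
    also have "\<dots> = 16 * A * (2 ^ k / (sqrt (real (r k)) * ?a))" by (simp add: mult_ac)
    also have "\<dots> \<le> 16 * A * 1"
    proof (intro mult_left_mono)
      \<comment> \<open>The block length cancels the logarithm: n / sqrt(n / m) is sqrt(n m), the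
        scale itself, so the mean of the excess is of the right order.\<close>
      have "(2::real) ^ k = sqrt (2 ^ k / ln (real k) * (2 ^ k * ln (real k)))" using 1 by simp
      also have "\<dots> \<le> sqrt (real (r k) * (2 ^ k * ln (real k)))"
        using r[OF k] 1 by (intro real_sqrt_le_mono mult_right_mono) auto
      also have "\<dots> = sqrt (real (r k)) * ?a" unfolding lil_scale_def by (rule real_sqrt_mult)
      finally show "2 ^ k / (sqrt (real (r k)) * ?a) \<le> 1" using a r[OF k] by simp
    qed (use A in auto)
    finally show "real (2 ^ k) * (\<integral>z. min (excess (b k) g z / ?a) 1 \<partial>M) \<le> 16 * A" by simp
  qed measurable
  have good: "supsum g n \<omega> \<le> (92 * A + 1) * lil_scale k"
    if k: "3 \<le> k" and \<omega>: "\<omega> \<in> space S" "\<omega> \<notin> B1 k \<union> B2 k" and n: "n \<le> 2 ^ k" for k \<omega> n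
  proof -
    have 1: "1 \<le> ln (real k)" by (rule ln_ge_1[OF k])
    have ex: "0 \<le> excess (b k) g z" for z
      using sup_norm_nonneg[OF bd, of z] by (auto simp: excess_def)
    \<comment> \<open>Since 7 sqrt(2) = sqrt(98) <= 10, the truncated sums contribute 6 * 10 * A;
      with 32 A + 1 from the excess this makes 92 A + 1.\<close>
    have "real (l k) * sqrt (real (r k)) \<le> 7 * ln (real k) * sqrt (2 * (2 ^ k / ln (real k)))"
      using l[OF k] r[OF k] 1 by (intro mult_mono real_sqrt_le_mono) auto
    also have "\<dots> = sqrt (98 * (2 ^ k * ln (real k)))"
      using 1 by (intro real_sqrt_unique[symmetric]) (auto simp: power2_eq_square field_simps)
    also have "\<dots> \<le> sqrt (100 * (2 ^ k * ln (real k)))"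
      using 1 by (intro real_sqrt_le_mono) auto
    also have "\<dots> = 10 * lil_scale k" by (simp add: lil_scale_def real_sqrt_mult)
    finally have "real (l k) * sqrt (real (r k)) \<le> 10 * lil_scale k" .
    from mult_left_mono[OF this, of "6 * A"] A
    have lv: "real (l k) * (6 * (A * sqrt (real (r k)))) \<le> 60 * A * lil_scale k" by (simp add: mult_ac)
    have "supsum g n \<omega> \<le> supsum (trunc (b k) g) n \<omega> + (\<Sum>i<n. excess (b k) g (\<omega> i))"
      by (rule supsum_le_trunc_excess[OF bd])
    also have "(\<Sum>i<n. excess (b k) g (\<omega> i)) \<le> (\<Sum>i<2 ^ k. excess (b k) g (\<omega> i))"
      using n ex by (intro sum_mono2) auto
    also have "\<dots> \<le> (2 * (16 * A) + 1) * lil_scale k"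
      using \<omega> by (auto simp: B2_def not_less)
    also have "supsum (trunc (b k) g) n \<omega> \<le> real (l k) * (6 * (A * sqrt (real (r k))))"
      using \<omega> n by (auto simp: B1_def not_less)
    also note lv
    finally show ?thesis by (simp add: algebra_simps)
  qed
  have sq: "summable (\<lambda>k. 1 / real (k + 3) ^ 2)"
    using inverse_power_summable[of 2, where 'a=real] summable_ignore_initial_segment[of "\<lambda>n. 1 / real n ^ 2" 3]
    by (simp add: inverse_eq_divide)
  have sb: "summable (\<lambda>k. \<beta> (k + 3))" using moment by (simp add: \<beta>_def)
  have "AE \<omega> in S. \<forall>\<^sub>F k in sequentially. \<omega> \<in> space S - (B1 (k + 3) \<union> B2 (k + 3))"
  proof (rule borel_cantelli_AE1)
    show "summable (\<lambda>k. P.prob (B1 (k + 3) \<union> B2 (k + 3)))"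
    proof (rule summable_comparison_test')
      show "summable (\<lambda>k. 1 / real (k + 3) ^ 2 + (\<beta> (k + 3) + exp 800 * (\<beta> (k + 3) + 1 / real (k + 3) ^ 2)))"
        by (intro summable_add summable_mult sq sb)
      fix k :: nat
      have "P.prob (B1 (k + 3) \<union> B2 (k + 3)) \<le> P.prob (B1 (k + 3)) + P.prob (B2 (k + 3))"
        by (intro measure_Un_le) measurable
      also have "\<dots> \<le> 1 / real (k + 3) ^ 2 + (\<beta> (k + 3) + exp 800 * (\<beta> (k + 3) + 1 / real (k + 3) ^ 2))"
        by (intro add_mono p1 p2) auto
      finally show "norm (P.prob (B1 (k + 3) \<union> B2 (k + 3)))
        \<le> 1 / real (k + 3) ^ 2 + (\<beta> (k + 3) + exp 800 * (\<beta> (k + 3) + 1 / real (k + 3) ^ 2))" by simp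
    qed
  qed (auto simp: P.emeasure_eq_measure)
  then show ?thesis
  proof eventually_elim
    case (elim \<omega>)
    then have "\<forall>\<^sub>F k in sequentially. \<forall>n\<le>2 ^ (k + 3). supsum g n \<omega> \<le> (92 * A + 1) * lil_scale (k + 3)"
    proof eventually_elim
      case (elim k)
      then show ?case using good[of "k + 3" \<omega>] by auto
    qed
    then show ?case
      by (rule iffD1[OF eventually_sequentially_seg])
  qed
qed

text \<open>From 2^k <= 2 n one gets k <= 4 ln n <= (ln n)^2, where n >= exp(4) is used, hence ln k
  <= 2 ln ln n. The factor 2 is the root of 2 * 2, one 2 from this and one from 2 n.\<close>

lemma lil_scale_le:
  assumes n: "exp 4 \<le> real n" and k: "2 ^ k \<le> 2 * n" "1 \<le> k"
  shows "lil_scale k \<le> 2 * sqrt (real n * ln (ln (real n)))"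
proof -
  have n0: "0 < real n" using n by (meson exp_gt_zero less_le_trans)
  have L: "4 \<le> ln (real n)" using n n0 by (simp add: ln_ge_iff)
  have "real (2 ^ k) \<le> real (2 * n)" using k(1) by (rule of_nat_mono)
  then have k': "2 ^ k \<le> 2 * real n" by simp
  then have "ln (2 ^ k) \<le> ln (2 * real n)" using n0 by (subst ln_le_cancel_iff) auto
  then have "real k * ln 2 \<le> ln 2 + ln (real n)" using n0 by (simp add: ln_realpow ln_mult)
  moreover have "(real k - 1) * (1 / 2) \<le> (real k - 1) * ln 2"
    using ln2_ge_two_thirds k by (intro mult_left_mono) auto
  ultimately have "real k \<le> 1 + 2 * ln (real n)"
    unfolding left_diff_distrib by linarith
  also have "\<dots> \<le> 4 * ln (real n)" using L by simp
  also have "\<dots> \<le> ln (real n) * ln (real n)" using L by (intro mult_right_mono) auto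
  finally have "ln (real k) \<le> ln (ln (real n) * ln (real n))"
    using k L by (subst ln_le_cancel_iff) auto
  then have lk: "ln (real k) \<le> 2 * ln (ln (real n))" using L by (simp add: ln_mult)
  have "lil_scale k \<le> sqrt (2 * real n * (2 * ln (ln (real n))))"
    unfolding lil_scale_def using k' lk k n0 by (intro real_sqrt_le_mono mult_mono) auto
  also have "\<dots> = sqrt (4 * (real n * ln (ln (real n))))" by (simp add: mult_ac)
  also have "\<dots> = 2 * sqrt (real n * ln (ln (real n)))" by (simp add: real_sqrt_mult)
  finally show ?thesis .
qed

lemma (in sequence_space) bounded_lil:
  assumes bd: "pointwise_bounded g" and gm: "\<And>j. g j \<in> borel_measurable M"
    and A: "0 < A" and tight: "\<And>n. 1 \<le> n \<Longrightarrow> \<P>(\<omega> in S. A * sqrt (real n) < supsum g n \<omega>) \<le> 1 / 8"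
    and moment: "summable (\<lambda>k. 2 ^ (k + 3) * (\<integral>z. min (sup_norm g z / lil_scale (k + 3)) 1 ^ 4 \<partial>M))"
  shows "AE \<omega> in S. \<forall>\<^sub>F n in sequentially. supsum g n \<omega> \<le> (184 * A + 2) * sqrt (real n * ln (ln (real n)))"
proof -
  have "AE \<omega> in S. \<forall>\<^sub>F k in sequentially. \<forall>n\<le>2 ^ k. supsum g n \<omega> \<le> (92 * A + 1) * lil_scale k"
    by (intro bounded_lil_dyadic bd gm A tight moment)
  then show ?thesis
  proof eventually_elim
    case (elim \<omega>)
    then obtain k0 where k0: "\<And>k n. k0 \<le> k \<Longrightarrow> n \<le> 2 ^ k \<Longrightarrow> supsum g n \<omega> \<le> (92 * A + 1) * lil_scale k"
      by (auto simp: eventually_sequentially)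
    have "\<forall>\<^sub>F n in sequentially. exp 4 \<le> real n"
      using filterlim_real_sequentially by (simp add: filterlim_at_top)
    moreover have "\<forall>\<^sub>F n in sequentially. 2 ^ k0 < n" by (rule eventually_gt_at_top)
    ultimately show ?case
    proof eventually_elim
      case (elim n)
      obtain k where k: "n \<le> 2 ^ k" using less_exp[of n] less_imp_le by blast
      \<comment> \<open>The least dyadic number above \<open>n\<close>, so that
        \<open>2 ^ m \<le> 2 * n\<close>.\<close>
      define m where "m = (LEAST k. n \<le> 2 ^ k)"
      have m: "n \<le> 2 ^ m" unfolding m_def using k by (rule LeastI)
      have "2 ^ k0 < (2 ^ m :: nat)" using m elim by linarith
      then have "k0 < m" by simp
      then obtain j where j: "m = Suc j" by (cases m) auto
      have "\<not> n \<le> 2 ^ j" using not_less_Least[of j "\<lambda>k. n \<le> 2 ^ k"] j by (simp add: m_def)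
      then have "2 ^ m \<le> 2 * n" using j by simp
      have "supsum g n \<omega> \<le> (92 * A + 1) * lil_scale m" using k0[of m n] m \<open>k0 < m\<close> by simp
      also have "\<dots> \<le> (92 * A + 1) * (2 * sqrt (real n * ln (ln (real n))))"
        using A \<open>2 ^ m \<le> 2 * n\<close> elim j by (intro mult_left_mono lil_scale_le) auto
      finally show ?case by (simp add: algebra_simps)
    qed
  qed
qed

section \<open>Donsker classes\<close>

context sequence_space
begin

text \<open>For the finitely many sample sizes that weak convergence does not control.\<close>

lemma prob_supsum_gt_small:
  assumes bd: "pointwise_bounded g" and gm: "\<And>j. g j \<in> borel_measurable M" and "0 < e"
  shows "\<exists>B. \<P>(\<omega> in S. B < supsum g n \<omega>) \<le> e"
proof -
  note [measurable] = supsum_measurable[OF bd gm]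
  let ?A = "\<lambda>i::nat. {\<omega>\<in>space S. real i < supsum g n \<omega>}"
  have "(\<lambda>i. P.prob (?A i)) \<longlonglongrightarrow> P.prob (\<Inter>i. ?A i)"
    by (intro P.finite_Lim_measure_decseq) (auto simp: decseq_def)
  also have "(\<Inter>i. ?A i) = {}"
  proof (intro equals0I)
    fix \<omega> assume \<omega>: "\<omega> \<in> (\<Inter>i. ?A i)"
    obtain i where "supsum g n \<omega> < real i" using reals_Archimedean2 by blast
    with \<omega> show False by (auto dest!: spec[of _ i])
  qed
  finally have "\<forall>\<^sub>F i in sequentially. P.prob (?A i) < e"
    using \<open>0 < e\<close> by (intro order_tendstoD) auto
  then obtain i where "P.prob (?A i) < e" by (auto simp: eventually_sequentially)
  then show ?thesis by (intro exI[of _ "real i"]) simp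
qed

text \<open>Every integrable majorant of \<open>T\<close> dominates the indicator of the event. The
  constant 1 is such a majorant, so the infimum is over a nonempty set.\<close>

lemma prob_le_outer_exp:
  assumes A: "{\<omega>\<in>space S. Q \<omega>} \<in> sets S"
    and T: "\<And>\<omega>. \<omega> \<in> space S \<Longrightarrow> Q \<omega> \<Longrightarrow> 1 \<le> T \<omega>" "\<And>\<omega>. 0 \<le> T \<omega>" "\<And>\<omega>. T \<omega> \<le> 1"
  shows "\<P>(\<omega> in S. Q \<omega>) \<le> outer_exp S T"
  unfolding outer_exp_def
proof (rule cInf_greatest)
  have "integral\<^sup>L S (\<lambda>_. 1) \<in> {integral\<^sup>L S U |U. U \<in> borel_measurable S \<and> integrable S U \<and> (\<forall>\<omega>\<in>space S. T \<omega> \<le> U \<omega>)}"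
    using T(3) by (intro CollectI exI[of _ "\<lambda>_. 1"]) auto
  then show "{integral\<^sup>L S U |U. U \<in> borel_measurable S \<and> integrable S U \<and> (\<forall>\<omega>\<in>space S. T \<omega> \<le> U \<omega>)} \<noteq> {}"
    by blast
next
  fix x assume "x \<in> {integral\<^sup>L S U |U. U \<in> borel_measurable S \<and> integrable S U \<and> (\<forall>\<omega>\<in>space S. T \<omega> \<le> U \<omega>)}"
  then obtain U where U: "integrable S U" "\<And>\<omega>. \<omega> \<in> space S \<Longrightarrow> T \<omega> \<le> U \<omega>" "x = integral\<^sup>L S U" by auto
  have "\<P>(\<omega> in S. Q \<omega>) = (\<integral>\<omega>. indicator {\<omega>\<in>space S. Q \<omega>} \<omega> \<partial>S)"
    by (simp add: sets.Int_space_eq2[OF A])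
  also have "\<dots> \<le> integral\<^sup>L S U"
  proof (rule integral_mono)
    show "integrable S (indicator {\<omega>\<in>space S. Q \<omega>} :: _ \<Rightarrow> real)"
      using A by (intro integrable_real_indicator) (auto simp: P.emeasure_eq_measure)
    show "indicator {\<omega>\<in>space S. Q \<omega>} \<omega> \<le> U \<omega>" if "\<omega> \<in> space S" for \<omega>
      using U(2)[OF that] T(1)[OF that] T(2)[of \<omega>] by (auto simp: indicator_def)
  qed (rule U)
  finally show "\<P>(\<omega> in S. Q \<omega>) \<le> x" using U by simp
qed

end

lemma emp_proc_eq:
  assumes "f \<in> F" "0 < n"
  shows "emp_proc P F n \<omega> f = (\<Sum>i<n. f (\<omega> i) - (\<integral>x. f x \<partial>P)) / sqrt (real n)"
proof -
  have "real n = sqrt (real n) * sqrt (real n)" by simp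
  then show ?thesis using assms
    by (simp add: emp_proc_def sum_subtractf field_simps)
qed

text \<open>A compact set carrying almost all of the limit law lies in a ball around the zero
  function. A continuous ramp that vanishes on this ball and equals 1 from twice the radius on has a
  small limiting integral, so its outer expectations, which dominate the probabilities of large
  sums, are eventually small.\<close>

lemma donsker_tight:
  fixes P :: "'z measure" and f :: "nat \<Rightarrow> 'z \<Rightarrow> real"
  assumes P: "prob_space P" and D: "donsker P F" and f: "\<And>j. f j \<in> F"
  defines "g \<equiv> (\<lambda>j z. f j z - (\<integral>x. f j x \<partial>P))"
  shows "pointwise_bounded g" (is ?bd)
    and "\<exists>A>0. \<forall>n\<ge>1. \<P>(\<omega> in PiM UNIV (\<lambda>_. P). A * sqrt (real n) < supsum g n \<omega>) \<le> 1 / 8"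
proof -
  interpret prob_space P by fact
  interpret sequence_space P ..
  define m where "m = linf_metric F"
  define X where "X = mtopology_of m"
  define c where "c x = (SUP h\<in>F. \<bar>h x - (\<integral>y. h y \<partial>P)\<bar>)" for x
  have bdF: "bdd_above ((\<lambda>h. \<bar>h x - (\<integral>y. h y \<partial>P)\<bar>) ` F)" for x
    using D[unfolded donsker_def, THEN conjunct2, THEN conjunct1] by (rule spec)
  have c: "\<bar>h x - (\<integral>y. h y \<partial>P)\<bar> \<le> c x" if "h \<in> F" for h x
    unfolding c_def by (rule cSUP_upper[OF that bdF])
  show bd: ?bd
    unfolding pointwise_bounded_def g_def
  proof
    fix z show "bdd_above (range (\<lambda>j. \<bar>f j z - (\<integral>x. f j x \<partial>P)\<bar>))"
      by (rule bdd_aboveI2[of _ _ "c z"]) (intro c f)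
  qed
  have int: "integrable P h" if "h \<in> F" for h 
    using D[unfolded donsker_def, THEN conjunct1] that by (rule bspec)
  have gm [measurable]: "g j \<in> borel_measurable P" for j
    using borel_measurable_integrable[OF int[OF f[of j]]] unfolding g_def by measurable
  note [measurable] = supsum_measurable[OF bd gm]
  have F0: "F \<noteq> {}" using f by auto
  from D[unfolded donsker_def, folded m_def, folded X_def, THEN conjunct2, THEN conjunct2]
  obtain L where L: "prob_space L"
    and tight: "\<forall>e>0. \<exists>K. compactin X K \<and> measure L K \<ge> 1 - e"
    and conv: "\<forall>h. continuous_map X euclideanreal h \<and> bounded (h ` topspace X) \<longrightarrow>
           (\<lambda>n. outer_exp S (\<lambda>\<omega>. h (emp_proc P F n \<omega>))) \<longlonglongrightarrow> (\<integral>g. h g \<partial>L)"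
    by - (erule exE, elim conjE, rule that, assumption+)
  interpret L: prob_space L by fact
  obtain K where K: "compactin X K" "measure L K \<ge> 1 - 1 / 16" using tight[rule_format, of "1/16"] by auto
  \<comment> \<open>A set that is not measurable has measure 0 by default, so the positive measure
    of \<open>K\<close> makes it measurable.\<close>
  have Ks: "K \<in> sets L" using K(2) measure_notin_sets[of K L] by auto
  define z0 where "z0 = restrict (\<lambda>_. 0 :: real) F"
  have msp: "mspace m = {h. h \<in> extensional F \<and> bounded (h ` F)}"
    by (simp add: m_def linf_metric_def Met_TC.fspace_def)
  have z0: "z0 \<in> mspace m" by (auto simp: msp z0_def bounded_iff)
  interpret mm: Metric_space "mspace m" "mdist m" by (rule Metric_space_mspace_mdist)
  have "mm.mbounded K"
    using K(1) unfolding X_def mtopology_of_def by (rule mm.compactin_imp_mbounded)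
  then have "mm.mbounded (insert z0 K)" using z0 by (simp add: mm.mbounded_insert)
  then obtain A0 where A0: "0 < A0" "\<And>k. k \<in> K \<Longrightarrow> mdist m z0 k \<le> A0"
    unfolding mm.mbounded_alt_pos by auto
  define h where "h k = max 0 (min 1 (mdist m z0 k / A0 - 1))" for k
  have "continuous_map X euclideanreal (\<lambda>k. mdist m z0 k)"
    unfolding X_def using z0 by (intro continuous_map_mdist) (auto simp: continuous_map_id[unfolded id_def])
  moreover have "continuous_map euclideanreal euclideanreal (\<lambda>t. max 0 (min 1 (t / A0 - 1)))"
    using A0 by (auto simp: continuous_map_iff_continuous2 intro!: continuous_intros)
  ultimately have "continuous_map X euclideanreal ((\<lambda>t. max 0 (min 1 (t / A0 - 1))) \<circ> (\<lambda>k. mdist m z0 k))"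
    by (rule continuous_map_compose)
  then have hc: "continuous_map X euclideanreal h" by (simp add: h_def[abs_def] o_def)
  have hb: "0 \<le> h k" "h k \<le> 1" for k by (auto simp: h_def)
  have "bounded (h ` topspace X)" using hb by (auto simp: bounded_iff intro!: exI[of _ 1])
  with hc have lim: "(\<lambda>n. outer_exp S (\<lambda>\<omega>. h (emp_proc P F n \<omega>))) \<longlonglongrightarrow> (\<integral>g. h g \<partial>L)"
    by (intro conv[rule_format] conjI)
  have "(\<integral>k. h k \<partial>L) \<le> 1 / 16"
  \<comment> \<open>Without integrability the Bochner integral is 0 by default and the bound is
    immediate.\<close>
  proof (cases "integrable L h")
    case True
    have "(\<integral>k. h k \<partial>L) \<le> (\<integral>k. indicator (space L - K) k \<partial>L)"
    proof (intro integral_mono True)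
      show "integrable L (indicator (space L - K) :: _ \<Rightarrow> real)"
        using Ks by (intro integrable_real_indicator) (auto simp: L.emeasure_eq_measure)
      fix k assume k: "k \<in> space L"
      have "h k = 0" if "k \<in> K"
      proof -
        have "mdist m z0 k / A0 \<le> 1" using A0(1) A0(2)[OF that] by simp
        then show ?thesis unfolding h_def by linarith
      qed
      then show "h k \<le> indicator (space L - K) k"
        using hb[of k] k by (auto simp: indicator_def)
    qed
    also have "\<dots> = 1 - measure L K" using Ks by (simp add: L.prob_compl)
    finally show ?thesis using K by simp
  qed (simp add: not_integrable_integral_eq)
  then have "\<forall>\<^sub>F n in sequentially. outer_exp S (\<lambda>\<omega>. h (emp_proc P F n \<omega>)) < 1 / 8"
    using lim by (intro order_tendstoD) auto
  then obtain n0 where n0: "\<And>n. n0 \<le> n \<Longrightarrow> outer_exp S (\<lambda>\<omega>. h (emp_proc P F n \<omega>)) < 1 / 8"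
    by (auto simp: eventually_sequentially)
  have large: "\<P>(\<omega> in S. 2 * A0 * sqrt (real n) < supsum g n \<omega>) \<le> 1 / 8" if n: "n0 \<le> n" "1 \<le> n" for n
  proof -
    have "\<P>(\<omega> in S. 2 * A0 * sqrt (real n) < supsum g n \<omega>) \<le> outer_exp S (\<lambda>\<omega>. h (emp_proc P F n \<omega>))"
    proof (rule prob_le_outer_exp)
      fix \<omega> assume \<omega>: "2 * A0 * sqrt (real n) < supsum g n \<omega>"
      have sn: "0 < sqrt (real n)" using n by simp
      obtain j where j: "2 * A0 * sqrt (real n) < \<bar>\<Sum>i<n. g j (\<omega> i)\<bar>"
        using \<omega> unfolding supsum_def
        by (subst (asm) less_cSUP_iff[OF _ bdd_above_abs_sum[OF bd]]) auto
      have ee: "\<bar>emp_proc P F n \<omega> k\<bar> \<le> (\<Sum>i<n. c (\<omega> i)) / sqrt (real n)" if "k \<in> F" for k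
      proof -
        have "\<bar>\<Sum>i<n. k (\<omega> i) - (\<integral>x. k x \<partial>P)\<bar> \<le> (\<Sum>i<n. c (\<omega> i))"
          by (rule order.trans[OF sum_abs]) (intro sum_mono c that)
        then show ?thesis using that n by (simp add: emp_proc_eq divide_right_mono)
      qed
      have em: "emp_proc P F n \<omega> \<in> mspace m"
      proof -
        have "bounded (emp_proc P F n \<omega> ` F)"
          unfolding bounded_iff by (intro exI[of _ "(\<Sum>i<n. c (\<omega> i)) / sqrt (real n)"]) (auto intro: ee)
        then show ?thesis unfolding msp by (simp add: emp_proc_def)
      qed
      \<comment> \<open>A trivial inequality, there to be unfolded by
        \<open>funspace_mdist_le\<close> into a bound on the distance at every function, in
        particular at \<open>f j\<close>.\<close>
      have "mdist m z0 (emp_proc P F n \<omega>) \<le> mdist m z0 (emp_proc P F n \<omega>)" by simp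
      then have "dist (z0 (f j)) (emp_proc P F n \<omega> (f j)) \<le> mdist m z0 (emp_proc P F n \<omega>)"
        using z0 em F0 f[of j] unfolding m_def linf_metric_def by (subst (asm) funspace_mdist_le) auto
      then have "\<bar>\<Sum>i<n. g j (\<omega> i)\<bar> / sqrt (real n) \<le> mdist m z0 (emp_proc P F n \<omega>)"
        using f[of j] n by (simp add: emp_proc_eq z0_def g_def dist_real_def)
      moreover have "2 * A0 < \<bar>\<Sum>i<n. g j (\<omega> i)\<bar> / sqrt (real n)" using j sn by (simp add: less_divide_eq)
      ultimately have "2 * A0 \<le> mdist m z0 (emp_proc P F n \<omega>)" by linarith
      then show "1 \<le> h (emp_proc P F n \<omega>)" using A0 by (simp add: h_def le_divide_eq)
    qed (use hb in auto)
    with n0[OF n(1)] show ?thesis by linarith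
  qed
  have "\<exists>B. \<P>(\<omega> in S. B < supsum g n \<omega>) \<le> 1 / 8" for n
    by (intro prob_supsum_gt_small bd gm) auto
  then obtain B where B: "\<And>n. \<P>(\<omega> in S. B n < supsum g n \<omega>) \<le> 1 / 8" by metis
  \<comment> \<open>Radius \<open>2 * A0\<close> serves the sample sizes from \<open>n0\<close> on;
    the sum covers the smaller ones.\<close>
  define A where "A = 2 * A0 + (\<Sum>n<n0. \<bar>B n\<bar>)"
  have s0: "0 \<le> (\<Sum>n<n0. \<bar>B n\<bar>)" by (intro sum_nonneg) auto
  have "\<P>(\<omega> in S. A * sqrt (real n) < supsum g n \<omega>) \<le> 1 / 8" if n: "1 \<le> n" for n
  proof (cases "n0 \<le> n")
    case True
    have "2 * A0 * sqrt (real n) \<le> A * sqrt (real n)" using s0 by (intro mult_right_mono) (auto simp: A_def)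
    then have "\<P>(\<omega> in S. A * sqrt (real n) < supsum g n \<omega>) \<le> \<P>(\<omega> in S. 2 * A0 * sqrt (real n) < supsum g n \<omega>)"
      by (intro P.finite_measure_mono) auto
    also have "\<dots> \<le> 1 / 8" by (rule large[OF True n])
    finally show ?thesis .
  next
    case False
    have "\<bar>B n\<bar> \<le> (\<Sum>n<n0. \<bar>B n\<bar>)" using False by (intro member_le_sum) auto
    then have "B n \<le> A * 1" using A0 by (simp add: A_def)
    also have "\<dots> \<le> A * sqrt (real n)" using n A0 s0 by (intro mult_left_mono) (auto simp: A_def)
    finally have "\<P>(\<omega> in S. A * sqrt (real n) < supsum g n \<omega>) \<le> \<P>(\<omega> in S. B n < supsum g n \<omega>)"
      by (intro P.finite_measure_mono) auto
    also have "\<dots> \<le> 1 / 8" by (rule B)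
    finally show ?thesis .
  qed
  moreover have "0 < A" using A0(1) s0 unfolding A_def by linarith
  ultimately show "\<exists>A>0. \<forall>n\<ge>1. \<P>(\<omega> in S. A * sqrt (real n) < supsum g n \<omega>) \<le> 1 / 8" by blast
qed

section \<open>From a dense sequence to a compact parameter set\<close>

lemma compact_imp_dense_sequence:
  fixes T :: "'t::metric_space set"
  assumes "compact T" "T \<noteq> {}"
  obtains d :: "nat \<Rightarrow> 't" where "range d \<subseteq> T" "closure (range d) = T"
proof -
  have "\<forall>e>0. \<exists>k. finite k \<and> k \<subseteq> T \<and> T \<subseteq> (\<Union>x\<in>k. ball x e)"
    using assms(1) by (intro seq_compact_imp_totally_bounded compact_imp_seq_compact)
  then obtain k where k: "\<And>e. 0 < e \<Longrightarrow> finite (k e) \<and> k e \<subseteq> T \<and> T \<subseteq> (\<Union>x\<in>k e. ball x e)"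
    by metis
  define D where "D = (\<Union>n::nat. k (1 / real (Suc n)))"
  have kn: "finite (k (1 / real (Suc n)))" "k (1 / real (Suc n)) \<subseteq> T"
    "T \<subseteq> (\<Union>x\<in>k (1 / real (Suc n)). ball x (1 / real (Suc n)))" for n
    using k[of "1 / real (Suc n)"] by auto
  have DT: "D \<subseteq> T" using kn(2) by (auto simp: D_def)
  have "countable D" unfolding D_def using kn(1) by (auto intro: countable_finite)
  have "k (1 / real (Suc 0)) \<noteq> {}" using kn(3)[of 0] assms(2) by (intro notI) simp
  then have "D \<noteq> {}" unfolding D_def by blast
  have "x \<in> closure D" if x: "x \<in> T" for x
    unfolding closure_approachable
  proof (intro allI impI)
    fix e :: real assume "0 < e"
    then obtain n where n: "1 / real (Suc n) < e" using reals_Archimedean[of e] by (auto simp: inverse_eq_divide)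
    from kn(3)[of n] x obtain y where "y \<in> k (1 / real (Suc n))" "dist y x < 1 / real (Suc n)" by auto
    with n show "\<exists>y\<in>D. dist y x < e" by (intro bexI[of _ y]) (auto simp: D_def)
  qed
  then have "closure D = T"
    using closure_minimal[OF DT compact_imp_closed[OF assms(1)]] by auto
  moreover have "range (from_nat_into D) = D"
    using \<open>countable D\<close> \<open>D \<noteq> {}\<close> by (rule range_from_nat_into[rotated])
  ultimately show ?thesis using DT by (intro that[of "from_nat_into D"]) auto
qed

lemma continuous_on_integral_dominated:
  fixes f :: "'t::metric_space \<Rightarrow> 'z \<Rightarrow> real"
  assumes meas: "\<And>t. t \<in> T \<Longrightarrow> f t \<in> borel_measurable P"
    and cont: "\<And>z. continuous_on T (\<lambda>t. f t z)"
    and bound: "\<And>t z. t \<in> T \<Longrightarrow> \<bar>f t z\<bar> \<le> G z" and G: "integrable P G"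
  shows "continuous_on T (\<lambda>t. \<integral>z. f t z \<partial>P)"
  unfolding continuous_on_sequentially o_def
proof (intro allI ballI impI)
  fix x a assume x: "a \<in> T" "(\<forall>n. x n \<in> T) \<and> x \<longlonglongrightarrow> a"
  have "(\<lambda>n. f (x n) z) \<longlonglongrightarrow> f a z" for z
    using cont[of z] x unfolding continuous_on_sequentially o_def by blast
  then show "(\<lambda>n. \<integral>z. f (x n) z \<partial>P) \<longlonglongrightarrow> (\<integral>z. f a z \<partial>P)"
    using x by (intro integral_dominated_convergence[where w=G] G AE_I2 meas) (auto intro: bound)
qed

text \<open>The sequence version is applied along a dense sequence of parameters, whose centred
  functions have envelope \<open>G\<close> plus its mean. Both the sums and the means are continuous
  in the parameter, so the bound extends to all of \<open>T\<close> with the same constant and the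
  same exceptional set.\<close>

theorem donsker_bounded_lil:
  fixes f :: "'t::metric_space \<Rightarrow> 'z \<Rightarrow> real"
  assumes prob: "prob_space P" and D: "donsker P (f ` T)" and T: "compact T" "T \<noteq> {}"
    and cont: "\<And>z. continuous_on T (\<lambda>t. f t z)"
    and bound: "\<And>t z. t \<in> T \<Longrightarrow> \<bar>f t z\<bar> \<le> G z"
    and G: "integrable P G" "integrable P (\<lambda>z. varphi (G z))"
  shows "\<exists>C. AE \<omega> in PiM UNIV (\<lambda>_::nat. P). \<forall>\<^sub>F n in sequentially. \<forall>t\<in>T.
           \<bar>\<Sum>i<n. f t (\<omega> i) - (\<integral>z. f t z \<partial>P)\<bar> \<le> C * sqrt (real n * ln (ln (real n)))"
proof -
  interpret prob_space P by fact
  interpret sequence_space P ..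
  obtain d :: "nat \<Rightarrow> 't" where d: "range d \<subseteq> T" "closure (range d) = T"
    using T by (rule compact_imp_dense_sequence)
  define g where "g = (\<lambda>j z. f (d j) z - (\<integral>x. f (d j) x \<partial>P))"
  have fd: "f (d j) \<in> f ` T" for j using d by auto
  have int: "integrable P (f t)" if "t \<in> T" for t
    using D[unfolded donsker_def, THEN conjunct1] that by auto
  have [measurable]: "f t \<in> borel_measurable P" if "t \<in> T" for t
    using int[OF that] by (rule borel_measurable_integrable)
  note tg = donsker_tight[where f="\<lambda>j. f (d j)", OF prob D fd, folded g_def]
  have gm: "g j \<in> borel_measurable P" for j
    using borel_measurable_integrable[OF int[OF subsetD[OF d(1)]], of "d j"] unfolding g_def by measurable
  from tg(2) obtain A where A: "0 < A"
    and tight: "\<forall>n\<ge>1. \<P>(\<omega> in S. A * sqrt (real n) < supsum g n \<omega>) \<le> 1 / 8"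
    by - (erule exE, erule conjE, rule that, assumption+)
  have G0: "0 \<le> G z" for z using bound[of "d 0" z] d by (smt (verit) range_subsetD)
  have mean: "\<bar>\<integral>z. f t z \<partial>P\<bar> \<le> (\<integral>z. G z \<partial>P)" if "t \<in> T" for t
  proof -
    have "\<bar>\<integral>z. f t z \<partial>P\<bar> \<le> (\<integral>z. \<bar>f t z\<bar> \<partial>P)" by (rule integral_abs_bound)
    also have "\<dots> \<le> (\<integral>z. G z \<partial>P)"
      using int[OF that] G(1) bound[OF that] by (intro integral_mono) auto
    finally show ?thesis .
  qed
  have sn: "sup_norm g z \<le> G z + (\<integral>z. G z \<partial>P)" for z
    unfolding sup_norm_def
  proof (rule cSUP_least)
    fix j
    have dj: "d j \<in> T" using d by auto
    show "\<bar>g j z\<bar> \<le> G z + (\<integral>z. G z \<partial>P)"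
      using bound[OF dj, of z] mean[OF dj] unfolding g_def by linarith
  qed simp
  have mom: "summable (\<lambda>k. 2 ^ (k + 3) * (\<integral>z. min (sup_norm g z / lil_scale (k + 3)) 1 ^ 4 \<partial>P))"
  proof (rule prob_space.summable_dyadic_moment[OF prob])
    show "sup_norm g z \<le> G z + (\<integral>z. G z \<partial>P)" for z by (rule sn)
    show "sup_norm g \<in> borel_measurable P" by (intro sup_norm_measurable tg(1) gm)
  qed (use G G0 in \<open>auto intro: sup_norm_nonneg[OF tg(1)] integral_nonneg\<close>)
  have "AE \<omega> in S. \<forall>\<^sub>F n in sequentially. supsum g n \<omega> \<le> (184 * A + 2) * sqrt (real n * ln (ln (real n)))"
    by (intro bounded_lil tg(1) gm A tight[rule_format] mom)
  then have "AE \<omega> in S. \<forall>\<^sub>F n in sequentially. \<forall>t\<in>T.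
      \<bar>\<Sum>i<n. f t (\<omega> i) - (\<integral>z. f t z \<partial>P)\<bar> \<le> (184 * A + 2) * sqrt (real n * ln (ln (real n)))"
  proof eventually_elim
    case (elim \<omega>)
    then show ?case
    proof eventually_elim
      case (elim n)
      show ?case
      proof
        fix t assume "t \<in> T"
        have "continuous_on T (\<lambda>t. \<integral>z. f t z \<partial>P)"
          by (intro continuous_on_integral_dominated[where G=G] cont bound G) auto
        then have c: "continuous_on (closure (range d)) (\<lambda>t. \<bar>\<Sum>i<n. f t (\<omega> i) - (\<integral>z. f t z \<partial>P)\<bar>)"
          unfolding d(2) by (intro continuous_intros cont)
        have "\<bar>\<Sum>i<n. f t (\<omega> i) - (\<integral>z. f t z \<partial>P)\<bar> \<le> supsum g n \<omega>"
        proof (rule continuous_le_on_closure[OF c])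
          show "t \<in> closure (range d)" using \<open>t \<in> T\<close> d by simp
          show "\<bar>\<Sum>i<n. f t (\<omega> i) - (\<integral>z. f t z \<partial>P)\<bar> \<le> supsum g n \<omega>" if "t \<in> range d" for t
            using that abs_sum_le_supsum[OF tg(1), of _ \<omega> n] by (auto simp: g_def)
        qed
        with elim show "\<bar>\<Sum>i<n. f t (\<omega> i) - (\<integral>z. f t z \<partial>P)\<bar> \<le> (184 * A + 2) * sqrt (real n * ln (ln (real n)))"
          by linarith
      qed
    qed
  qed
  then show ?thesis by (rule exI)
qed

section \<open>Kullback-Leibler divergence and selection criteria\<close>

lemma prob_space_density_integral_ratio:
  fixes p q :: "'z \<Rightarrow> real"
  assumes [measurable]: "p \<in> borel_measurable mu" "q \<in> borel_measurable mu"
    and pos: "\<And>z. 0 < p z" "\<And>z. 0 < q z" and P: "prob_space (density mu p)"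
  shows "integrable (density mu q) (\<lambda>z. p z / q z)" "(\<integral>z. p z / q z \<partial>density mu q) = 1"
proof -
  interpret Q: prob_space "density mu p" by fact
  have "(\<integral>\<^sup>+z. ennreal (p z / q z) \<partial>density mu q) = (\<integral>\<^sup>+z. ennreal (q z) * ennreal (p z / q z) \<partial>mu)"
    by (subst nn_integral_density) auto
  also have "\<dots> = (\<integral>\<^sup>+z. ennreal (p z) \<partial>mu)"
    using pos less_imp_le[OF pos(2)] less_imp_neq[OF pos(2)] less_imp_le[OF pos(1)]
    by (intro nn_integral_cong) (auto simp flip: ennreal_mult)
  also have "\<dots> = emeasure (density mu p) (space (density mu p))"
    by (simp add: emeasure_density cong: nn_integral_cong)
  also have "\<dots> = 1" by (rule Q.emeasure_space_1)
  finally have 1: "(\<integral>\<^sup>+z. ennreal (p z / q z) \<partial>density mu q) = ennreal 1" by simp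
  have 0: "0 \<le> p z / q z" for z using pos[of z] by (simp add: less_imp_le)
  show "integrable (density mu q) (\<lambda>z. p z / q z)" "(\<integral>z. p z / q z \<partial>density mu q) = 1"
    using nn_integral_eq_integrable[of "\<lambda>z. p z / q z" "density mu q" 1] 1 0 by auto
qed

text \<open>Integrate ln x <= x - 1 at x = p / q. Equality of the integrals forces x = 1 almost
  everywhere for the second law, and hence for \<open>mu\<close> because \<open>q\<close> is
  positive; the two densities would then define the same measure.\<close>

lemma gibbs_strict:
  fixes p q :: "'z \<Rightarrow> real"
  assumes [measurable]: "p \<in> borel_measurable mu" "q \<in> borel_measurable mu"
    and pos: "\<And>z. 0 < p z" "\<And>z. 0 < q z"
    and P: "prob_space (density mu p)" and Q: "prob_space (density mu q)"
    and int: "integrable (density mu q) (\<lambda>z. ln (p z) - ln (q z))"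
    and ne: "density mu p \<noteq> density mu q"
  shows "(\<integral>z. ln (p z) - ln (q z) \<partial>density mu q) < 0"
proof (rule ccontr)
  interpret Q: prob_space "density mu q" by fact
  note r = prob_space_density_integral_ratio[of p mu q, OF assms(1,2) pos P]
  let ?d = "\<lambda>z. p z / q z - 1 - (ln (p z) - ln (q z))"
  have ln: "ln (p z) - ln (q z) = ln (p z / q z)" for z using pos[of z] by (simp add: ln_div)
  have r0: "0 < p z / q z" for z using pos[of z] by simp
  have d0: "0 \<le> ?d z" for z using ln_le_minus_one[OF r0[of z]] by (simp add: ln)
  have di: "integrable (density mu q) ?d" using r int by auto
  assume "\<not> (\<integral>z. ln (p z) - ln (q z) \<partial>density mu q) < 0"
  then have "(\<integral>z. ?d z \<partial>density mu q) \<le> 0"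
    using r int Q.prob_space by simp
  moreover have "0 \<le> (\<integral>z. ?d z \<partial>density mu q)" using d0 by (rule Bochner_Integration.integral_nonneg)
  ultimately have "(\<integral>z. ?d z \<partial>density mu q) = 0" by simp
  then have "AE z in density mu q. ?d z = 0"
    using di d0 by (subst (asm) integral_nonneg_eq_0_iff_AE) auto
  then have "AE z in mu. 0 < ennreal (q z) \<longrightarrow> ?d z = 0"
    by (subst (asm) AE_density) auto
  then have "AE z in mu. ennreal (p z) = ennreal (q z)"
  proof eventually_elim
    case (elim z)
    then have "ln (p z / q z) = p z / q z - 1" using pos[of z] by (simp add: ln)
    from ln_eq_minus_one[OF r0 this] show ?case using pos[of z] by simp
  qed
  then have "density mu p = density mu q" by (intro density_cong) auto
  with ne show False by simp
qed

text \<open>The ratio q / p is a version of the derivative in \<open>KL\<close>. Integrability makes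
  both the positive and the negative part finite, so their difference is a real integral.\<close>

lemma KL_density:
  fixes p q :: "'z \<Rightarrow> real"
  assumes [measurable]: "p \<in> borel_measurable mu" "q \<in> borel_measurable mu"
    and pos: "\<And>z. 0 < p z" "\<And>z. 0 < q z"
    and P: "prob_space (density mu p)" and Q: "prob_space (density mu q)"
    and int: "integrable (density mu q) (\<lambda>z. ln (p z) - ln (q z))"
  shows "KL (density mu q) (density mu p) = ereal (- (\<integral>z. ln (p z) - ln (q z) \<partial>density mu q))"
proof -
  let ?P = "density mu p" and ?Q = "density mu q"
  interpret P: prob_space ?P by fact
  have eq: "density ?P (\<lambda>z. ennreal (q z / p z)) = ?Q"
    using pos less_imp_le[OF pos(1)] less_imp_le[OF pos(2)] less_imp_neq[OF pos(1)]
    by (subst density_density_eq) (auto intro!: density_cong simp flip: ennreal_mult)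
  have ac: "absolutely_continuous ?P ?Q"
    unfolding eq[symmetric] by (intro absolutely_continuousI_density) measurable
  have "AE z in ?P. ennreal (q z / p z) = RN_deriv ?P ?Q z"
    by (intro P.RN_deriv_unique eq) measurable
  \<comment> \<open>Uniqueness of the derivative holds almost everywhere for \<open>?P\<close>,
    whereas \<open>KL\<close> integrates over \<open>?Q\<close>; absolute continuity transfers
    it.\<close>
  then have "AE z in ?Q. ennreal (q z / p z) = RN_deriv ?P ?Q z"
    by (rule absolutely_continuous_AE[OF _ ac, rotated]) simp
  then have AE: "AE z in ?Q. ln (enn2real (RN_deriv ?P ?Q z)) = ln (q z) - ln (p z)"
  proof eventually_elim
    case (elim z)
    then have "enn2real (RN_deriv ?P ?Q z) = q z / p z" using pos[of z] by (metis divide_nonneg_nonneg enn2real_ennreal less_imp_le)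
    then show ?case using pos[of z] by (simp add: ln_div)
  qed
  let ?f = "\<lambda>z. ln (q z) - ln (p z)"
  have fi: "integrable ?Q ?f" using integrable_minus[OF int] by simp
  have 1: "(\<integral>\<^sup>+z. ennreal (max 0 (ln (enn2real (RN_deriv ?P ?Q z)))) \<partial>?Q) = ennreal (\<integral>z. max 0 (?f z) \<partial>?Q)"
  proof -
    have "(\<integral>\<^sup>+z. ennreal (max 0 (ln (enn2real (RN_deriv ?P ?Q z)))) \<partial>?Q) = (\<integral>\<^sup>+z. ennreal (max 0 (?f z)) \<partial>?Q)"
      using AE by (intro nn_integral_cong_AE) auto
    also have "\<dots> = ennreal (\<integral>z. max 0 (?f z) \<partial>?Q)"
      using fi by (intro nn_integral_eq_integral integrable_max) auto
    finally show ?thesis .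
  qed
  have 2: "(\<integral>\<^sup>+z. ennreal (max 0 (- ln (enn2real (RN_deriv ?P ?Q z)))) \<partial>?Q) = ennreal (\<integral>z. max 0 (- ?f z) \<partial>?Q)"
  proof -
    have "(\<integral>\<^sup>+z. ennreal (max 0 (- ln (enn2real (RN_deriv ?P ?Q z)))) \<partial>?Q) = (\<integral>\<^sup>+z. ennreal (max 0 (- ?f z)) \<partial>?Q)"
      using AE by (intro nn_integral_cong_AE) auto
    also have "\<dots> = ennreal (\<integral>z. max 0 (- ?f z) \<partial>?Q)"
      using integrable_minus[OF fi] by (intro nn_integral_eq_integral integrable_max) auto
    finally show ?thesis .
  qed
  have "KL ?Q ?P = enn2ereal (\<integral>\<^sup>+z. ennreal (max 0 (ln (enn2real (RN_deriv ?P ?Q z)))) \<partial>?Q)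
      - enn2ereal (\<integral>\<^sup>+z. ennreal (max 0 (- ln (enn2real (RN_deriv ?P ?Q z)))) \<partial>?Q)"
    unfolding KL_def using ac by (intro if_P) simp
  also have "\<dots> = ereal (\<integral>z. max 0 (?f z) \<partial>?Q) - ereal (\<integral>z. max 0 (- ?f z) \<partial>?Q)"
    unfolding 1 2 by (simp only: enn2ereal_ennreal Bochner_Integration.integral_nonneg max.cobounded1)
  also have "\<dots> = ereal ((\<integral>z. max 0 (?f z) \<partial>?Q) - (\<integral>z. max 0 (- ?f z) \<partial>?Q))" by simp
  also have "(\<integral>z. max 0 (?f z) \<partial>?Q) - (\<integral>z. max 0 (- ?f z) \<partial>?Q) = (\<integral>z. max 0 (?f z) - max 0 (- ?f z) \<partial>?Q)"
    using fi integrable_minus[OF fi] by (intro Bochner_Integration.integral_diff[symmetric] integrable_max) auto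
  also have "\<dots> = (\<integral>z. - (ln (p z) - ln (q z)) \<partial>?Q)"
    by (intro Bochner_Integration.integral_cong) auto
  also have "\<dots> = - (\<integral>z. ln (p z) - ln (q z) \<partial>?Q)" by (rule integral_minus)
  finally show ?thesis .
qed

section \<open>Comparing the criteria\<close>

lemma crit_upper:
  assumes "\<And>\<theta>. \<theta> \<in> Theta K \<Longrightarrow> (\<Sum>i<n. ln (p \<theta> (Z i \<omega>))) \<le> x"
  shows "crit p Theta pen Z n K \<omega> \<le> ereal (x - pen n K)"
proof -
  \<comment> \<open>An empty \<open>Theta K\<close> is included: its supremum is minus
    infinity.\<close>
  have "(SUP \<theta>\<in>Theta K. ereal (\<Sum>i<n. ln (p \<theta> (Z i \<omega>)))) \<le> ereal x"
    using assms by (intro SUP_least) auto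
  then have "crit p Theta pen Z n K \<omega> \<le> ereal x - ereal (pen n K)"
    unfolding crit_def by (intro ereal_minus_mono) auto
  then show ?thesis by simp
qed

lemma crit_lower:
  assumes "\<theta> \<in> Theta K"
  shows "ereal ((\<Sum>i<n. ln (p \<theta> (Z i \<omega>))) - pen n K) \<le> crit p Theta pen Z n K \<omega>"
proof -
  have "ereal (\<Sum>i<n. ln (p \<theta> (Z i \<omega>))) - ereal (pen n K) \<le> crit p Theta pen Z n K \<omega>"
    unfolding crit_def using assms by (intro ereal_minus_mono SUP_upper) auto
  then show ?thesis by simp
qed

lemma KhatL_eqI:
  assumes "1 \<le> K0" "crit p Theta pen Z n (Suc K0) \<omega> \<le> crit p Theta pen Z n K0 \<omega>"
    and "\<And>K. 1 \<le> K \<Longrightarrow> K < K0 \<Longrightarrow> crit p Theta pen Z n K \<omega> < crit p Theta pen Z n (Suc K) \<omega>"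
  shows "KhatL p Theta pen Z n \<omega> = enat K0"
  unfolding KhatL_def
proof (rule antisym)
  show "(INF K\<in>{K. 1 \<le> K \<and> crit p Theta pen Z n (Suc K) \<omega> \<le> crit p Theta pen Z n K \<omega>}. enat K) \<le> enat K0"
    using assms by (intro INF_lower) auto
  show "enat K0 \<le> (INF K\<in>{K. 1 \<le> K \<and> crit p Theta pen Z n (Suc K) \<omega> \<le> crit p Theta pen Z n K \<omega>}. enat K)"
    using assms(3) by (intro INF_greatest) (auto simp: not_less[symmetric])
qed

lemma KhatG_eqI:
  assumes K0: "1 \<le> K0" "K0 \<le> Kmax"
    and less: "\<And>K. 1 \<le> K \<Longrightarrow> K < K0 \<Longrightarrow> crit p Theta pen Z n K \<omega> < crit p Theta pen Z n K0 \<omega>"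
    and le: "\<And>K. K0 < K \<Longrightarrow> K \<le> Kmax \<Longrightarrow> crit p Theta pen Z n K \<omega> \<le> crit p Theta pen Z n K0 \<omega>"
  shows "KhatG p Theta pen Z Kmax n \<omega> = K0"
  unfolding KhatG_def
proof (rule Least_equality)
  have "crit p Theta pen Z n K \<omega> \<le> crit p Theta pen Z n K0 \<omega>" if "K \<in> {1..Kmax}" for K
    using that less[of K] le[of K] by (cases K K0 rule: linorder_cases) auto
  then show "K0 \<in> {1..Kmax} \<and> (\<forall>K'\<in>{1..Kmax}. crit p Theta pen Z n K' \<omega> \<le> crit p Theta pen Z n K0 \<omega>)"
    using K0 by auto
next
  fix K assume K: "K \<in> {1..Kmax} \<and> (\<forall>K'\<in>{1..Kmax}. crit p Theta pen Z n K' \<omega> \<le> crit p Theta pen Z n K \<omega>)"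
  show "K0 \<le> K"
  proof (rule ccontr)
    assume "\<not> K0 \<le> K"
    then have "crit p Theta pen Z n K \<omega> < crit p Theta pen Z n K0 \<omega>" using K by (intro less) auto
    moreover have "crit p Theta pen Z n K0 \<omega> \<le> crit p Theta pen Z n K \<omega>" using K K0 by auto
    ultimately show False by simp
  qed
qed

theorem theorem3:
  fixes mu :: "'z::polish_space measure"
    and M :: "'w measure"
    and Z :: "nat \<Rightarrow> 'w \<Rightarrow> 'z"
    and Pstar :: "'z measure"
    and pstar :: "'z \<Rightarrow> real"
    and Theta :: "nat \<Rightarrow> 't::metric_space set"
    and p :: "'t \<Rightarrow> 'z \<Rightarrow> real"
    and l u :: "'z \<Rightarrow> real"
    and pen :: "nat \<Rightarrow> nat \<Rightarrow> real"
    and Kstar :: nat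
  assumes mu: "sets mu = sets borel" "sigma_finite_measure mu"
    and M: "prob_space M"
    and Z_meas: "\<And>i. Z i \<in> measurable M borel"
    and Z_indep: "prob_space.indep_vars M (\<lambda>_. borel) Z UNIV"
    and Z_law: "\<And>i. distr M borel (Z i) = Pstar"
    and pstar_dens: "Pstar = density mu pstar" "pstar \<in> borel_measurable borel"
    and Theta_nested: "\<And>K. 1 \<le> K \<Longrightarrow> Theta K \<subseteq> Theta (Suc K)"
    and p_dens: "\<And>K \<theta>. 1 \<le> K \<Longrightarrow> \<theta> \<in> Theta K \<Longrightarrow>
                   p \<theta> \<in> borel_measurable borel \<and> prob_space (density mu (p \<theta>))"
    \<comment> \<open>(A1)\<close>
    and A1_Theta: "\<And>K. 1 \<le> K \<Longrightarrow> compact (Theta K)"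
    and A1_Pi: "\<And>K. 1 \<le> K \<Longrightarrow> compactin weak_topology (models mu p Theta K)"
    \<comment> \<open>(A2)\<close>
    and A2: "\<And>K z. 1 \<le> K \<Longrightarrow> continuous_on (Theta K) (\<lambda>\<theta>. ln (p \<theta> z))"
    \<comment> \<open>(A3); positivity of the densities is forced by l \<le> log p with l real-valued\<close>
    and A3_int: "integrable Pstar (\<lambda>z. u z - l z)"
    and A3_star: "\<And>z. 0 < pstar z \<and> l z \<le> ln (pstar z) \<and> ln (pstar z) \<le> u z"
    and A3_theta: "\<And>K \<theta> z. 1 \<le> K \<Longrightarrow> \<theta> \<in> Theta K \<Longrightarrow>
                     0 < p \<theta> z \<and> l z \<le> ln (p \<theta> z) \<and> ln (p \<theta> z) \<le> u z"
    \<comment> \<open>(A4)\<close>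
    and A4_pos: "\<And>n K. 1 \<le> K \<Longrightarrow> 0 < pen n K"
    and A4_mono: "\<And>n K. 1 \<le> K \<Longrightarrow> pen n K \<le> pen n (Suc K)"
    and A4_infty: "\<And>K. 1 \<le> K \<Longrightarrow> filterlim (\<lambda>n. pen n K) at_top sequentially"
    and A4_o: "\<And>K. 1 \<le> K \<Longrightarrow> (\<lambda>n. pen n K / real n) \<longlonglongrightarrow> 0"
    \<comment> \<open>measurability of the suprema\<close>
    and sup_meas: "\<And>n K. 1 \<le> K \<Longrightarrow>
        (\<lambda>\<omega>. SUP \<theta>\<in>Theta K. ereal (\<Sum>i<n. ln (p \<theta> (Z i \<omega>)))) \<in> borel_measurable M"
    \<comment> \<open>order of P*\<close>
    and Kstar: "1 \<le> Kstar" "Pstar \<in> models mu p Theta Kstar"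
               "Pstar \<notin> models mu p Theta (Kstar - 1)"
    and phi_int: "integrable Pstar (\<lambda>z. varphi (u z - l z))"
    and pen_ratio: "\<And>K. 1 \<le> K \<Longrightarrow> liminf (\<lambda>n. ereal (pen n (Suc K) / pen n K)) > 1"
    and pen_lil: "\<And>K. 1 \<le> K \<Longrightarrow>
        limsup (\<lambda>n. ereal (sqrt (real n * ln (ln (real n))) / pen n K)) = 0"
  shows "((\<forall>K\<ge>1. Pstar \<notin> models mu p Theta K \<longrightarrow>
             KLset Pstar (models mu p Theta (Suc K)) < KLset Pstar (models mu p Theta K))
          \<and> donsker Pstar (Ga p pstar Theta (Suc Kstar))
          \<longrightarrow> (AE \<omega> in M. \<forall>\<^sub>F n in sequentially. KhatL p Theta pen Z n \<omega> = enat Kstar))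
       \<and> (\<forall>Kmax. Kstar \<le> Kmax \<and> donsker Pstar (Ga p pstar Theta Kmax)
          \<longrightarrow> (AE \<omega> in M. \<forall>\<^sub>F n in sequentially. KhatG p Theta pen Z Kmax n \<omega> = Kstar))"
proof -
  interpret M: prob_space M by fact
  let ?f = "\<lambda>\<theta> z. ln (p \<theta> z) - ln (pstar z)"
  \<comment> \<open>The drift of the log-likelihood ratio, that is, minus the divergence of
    \<open>Pstar\<close> from the model with parameter \<open>\<theta>\<close> (see
    \<open>KL_ef\<close> below).\<close>
  define ef where "ef \<theta> = (\<integral>z. ?f \<theta> z \<partial>Pstar)" for \<theta>
  define s where "s n = sqrt (real n * ln (ln (real n)))" for n :: nat
  define cr where "cr n K \<omega> = crit p Theta pen Z n K \<omega>" for n K \<omega>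
  have sets_P: "sets Pstar = sets borel" using Z_law[of 0] by (metis sets_distr)
  have prob_P: "prob_space Pstar" using M.prob_space_distr[OF Z_meas[of 0]] Z_law[of 0] by simp
  have mu_meas: "borel_measurable mu = borel_measurable borel" by (rule measurable_cong_sets[OF mu(1) refl])
  have P_meas: "borel_measurable Pstar = borel_measurable borel" by (rule measurable_cong_sets[OF sets_P refl])
  have Theta_mono: "Theta K \<subseteq> Theta K'" if "1 \<le> K" "K \<le> K'" for K K'
    using that(2)
  proof (induction rule: dec_induct)
    case (step j)
    then show ?case using Theta_nested[of j] that(1) by auto
  qed simp
  have pen_mono: "pen n K \<le> pen n K'" if "1 \<le> K" "K \<le> K'" for n K K'
    using that(2)
  proof (induction rule: dec_induct)
    case (step j)
    then show ?case using A4_mono[of j n] that(1) by linarith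
  qed simp
  have p_meas: "p \<theta> \<in> borel_measurable borel" and p_prob: "prob_space (density mu (p \<theta>))"
    if "1 \<le> K" "\<theta> \<in> Theta K" for K \<theta> using p_dens[OF that] by auto
  have p_pos: "0 < p \<theta> z" if "1 \<le> K" "\<theta> \<in> Theta K" for K \<theta> z using A3_theta[OF that] by auto
  have f_bound: "\<bar>?f \<theta> z\<bar> \<le> u z - l z" if "1 \<le> K" "\<theta> \<in> Theta K" for K \<theta> z
    using A3_theta[OF that, of z] A3_star[of z] by linarith
  have f_meas: "?f \<theta> \<in> borel_measurable Pstar" if "1 \<le> K" "\<theta> \<in> Theta K" for K \<theta>
  proof -
    note [measurable] = p_meas[OF that] pstar_dens(2)
    show ?thesis unfolding P_meas by measurable
  qed
  have f_int: "integrable Pstar (?f \<theta>)" if "1 \<le> K" "\<theta> \<in> Theta K" for K \<theta>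
    using A3_int by (rule Bochner_Integration.integrable_bound)
      (use f_meas[OF that] in \<open>auto intro!: AE_I2 order.trans[OF f_bound[OF that]]\<close>)
  have f_cont: "continuous_on (Theta K) (\<lambda>\<theta>. ?f \<theta> z)" if "1 \<le> K" for K z
    by (intro continuous_intros A2[OF that])
  have ef_cont: "continuous_on (Theta K) ef" if "1 \<le> K" for K
    unfolding ef_def[abs_def]
    by (rule continuous_on_integral_dominated[where G="\<lambda>z. u z - l z"])
       (use f_meas[OF that] f_cont[OF that] f_bound[OF that] A3_int in auto)
  have ef_neg: "ef \<theta> < 0" if "1 \<le> K" "\<theta> \<in> Theta K" "density mu (p \<theta>) \<noteq> Pstar" for K \<theta>
    unfolding ef_def pstar_dens(1)
    using p_meas[OF that(1,2)] p_prob[OF that(1,2)] p_pos[OF that(1,2)] A3_star that(3) prob_P f_int[OF that(1,2)]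
    by (intro gibbs_strict) (auto simp: mu_meas pstar_dens)
  have KL_ef: "KL Pstar (density mu (p \<theta>)) = ereal (- ef \<theta>)" if "1 \<le> K" "\<theta> \<in> Theta K" for K \<theta>
    unfolding ef_def pstar_dens(1)
    using p_meas[OF that(1,2)] p_prob[OF that(1,2)] p_pos[OF that(1,2)] A3_star prob_P f_int[OF that(1,2)]
    by (intro KL_density) (auto simp: mu_meas pstar_dens)
  obtain \<theta>s where \<theta>s: "\<theta>s \<in> Theta Kstar" "Pstar = density mu (p \<theta>s)"
    using Kstar(1,2) by (auto simp: models_def split: if_splits)
  have ef_s: "ef \<theta>s = 0"
  proof -
    \<comment> \<open>Equal measures have densities that agree only almost everywhere, so the drift
      vanishes only after integration.\<close>
    have "AE z in mu. ennreal (p \<theta>s z) = ennreal (pstar z)"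
      using p_meas[OF Kstar(1) \<theta>s(1)] pstar_dens \<theta>s(2)
      by (intro sigma_finite_measure.density_unique[OF mu(2)]) (auto simp: mu_meas)
    then have "AE z in Pstar. ?f \<theta>s z = 0"
      unfolding pstar_dens(1) using pstar_dens(2)
    proof (subst AE_density, simp add: mu_meas, eventually_elim)
      case (elim z)
      then show ?case using p_pos[OF Kstar(1) \<theta>s(1), of z] A3_star[of z] by (simp add: less_imp_le)
    qed
    then have "ef \<theta>s = (\<integral>z. 0 \<partial>Pstar)"
      unfolding ef_def using f_meas[OF Kstar(1) \<theta>s(1)] by (intro integral_cong_AE) auto
    then show ?thesis by simp
  qed
  have ef_le_0: "ef \<theta> \<le> 0" if "1 \<le> K" "\<theta> \<in> Theta K" for K \<theta>
  proof (cases "density mu (p \<theta>) = Pstar")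
    case True
    then have "KL Pstar (density mu (p \<theta>)) = KL Pstar (density mu (p \<theta>s))" using \<theta>s(2) by simp
    then show ?thesis using KL_ef[OF that] KL_ef[OF Kstar(1) \<theta>s(1)] ef_s by simp
  qed (use ef_neg[OF that] in simp)
  have not_model: "density mu (p \<theta>) \<noteq> Pstar" if "1 \<le> K" "K < Kstar" "\<theta> \<in> Theta K" for K \<theta>
  proof -
    have "K \<le> Kstar - 1" using that by simp
    then have "\<theta> \<in> Theta (Kstar - 1)" using Theta_mono[OF that(1)] that(3) by blast
    then show ?thesis using Kstar(3) that by (auto simp: models_def)
  qed
  have s_pen: "\<forall>\<^sub>F n in sequentially. c * s n \<le> e * pen n K" if "1 \<le> K" "0 < e" for c e K
  proof -
    \<comment> \<open>The constants from the law of the iterated logarithm come without a sign; a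
      positive majorant permits the division.\<close>
    define c' where "c' = \<bar>c\<bar> + 1"
    have c': "0 < c'" "c \<le> c'" by (auto simp: c'_def)
    have "limsup (\<lambda>n. ereal (sqrt (real n * ln (ln (real n))) / pen n K)) < ereal (e / c')"
      unfolding pen_lil[OF that(1)] using that c' by simp
    then have "\<forall>\<^sub>F n in sequentially. ereal (sqrt (real n * ln (ln (real n))) / pen n K) < ereal (e / c')"
      by (rule Limsup_lessD)
    \<comment> \<open>From here on ln ln n is nonnegative, and so is \<open>s n\<close>; the real
      \<open>sqrt\<close> of a negative number is negative.\<close>
    moreover have "\<forall>\<^sub>F n in sequentially. exp 1 \<le> real n"
      using filterlim_real_sequentially by (simp add: filterlim_at_top)
    ultimately show ?thesis
    proof eventually_elim
      case (elim n)
      then have "0 < real n" by (meson exp_gt_zero less_le_trans)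
      then have "1 \<le> ln (real n)" using elim by (simp add: ln_ge_iff)
      then have "0 \<le> s n" by (simp add: s_def)
      then have "c * s n \<le> c' * s n" using c' by (intro mult_right_mono)
      also have "\<dots> \<le> e * pen n K"
        using elim(1) A4_pos[OF that(1), of n] c' by (simp add: s_def field_simps)
      finally show ?case .
    qed
  qed
  have pen_n: "\<forall>\<^sub>F n in sequentially. pen n K \<le> e * real n" if "1 \<le> K" "0 < e" for e K
  proof -
    have "\<forall>\<^sub>F n in sequentially. pen n K / real n < e"
      using order_tendstoD(2)[OF A4_o[OF that(1)] that(2)] .
    moreover have "\<forall>\<^sub>F n in sequentially. 0 < n" by (rule eventually_gt_at_top)
    ultimately show ?thesis by eventually_elim (simp add: field_simps)
  qed
  have lil: "\<exists>C. AE \<omega> in M. \<forall>\<^sub>F n in sequentially. \<forall>\<theta>\<in>Theta Kb.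
      \<bar>(\<Sum>i<n. ln (p \<theta> (Z i \<omega>))) - (\<Sum>i<n. ln (pstar (Z i \<omega>))) - real n * ef \<theta>\<bar> \<le> C * s n"
    if Kb: "Kstar \<le> Kb" and D: "donsker Pstar (Ga p pstar Theta Kb)" for Kb
  proof -
    have Kb1: "1 \<le> Kb" using Kb Kstar(1) by simp
    have "Ga p pstar Theta Kb = ?f ` Theta Kb" by (auto simp: Ga_def)
    with D have D': "donsker Pstar (?f ` Theta Kb)" by simp
    have ne: "Theta Kb \<noteq> {}" using Theta_mono[OF Kstar(1) Kb] \<theta>s by auto
    obtain C where C: "AE \<omega> in PiM UNIV (\<lambda>_::nat. Pstar). \<forall>\<^sub>F n in sequentially. \<forall>\<theta>\<in>Theta Kb.
           \<bar>\<Sum>i<n. ?f \<theta> (\<omega> i) - (\<integral>z. ?f \<theta> z \<partial>Pstar)\<bar> \<le> C * sqrt (real n * ln (ln (real n)))"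
      using donsker_bounded_lil[OF prob_P D' A1_Theta[OF Kb1] ne f_cont[OF Kb1] f_bound[OF Kb1] A3_int phi_int]
      by auto
    \<comment> \<open>Independence makes the product measure the law of the whole sequence of
      observations, so the almost sure bound can be pulled back to \<open>M\<close>.\<close>
    have "distr M (PiM UNIV (\<lambda>_::nat. borel)) (\<lambda>\<omega>. \<lambda>i\<in>UNIV. Z i \<omega>) = PiM UNIV (\<lambda>i::nat. distr M borel (Z i))"
      using Z_indep by (intro M.indep_vars_iff_distr_eq_PiM[THEN iffD1] Z_meas) auto
    then have "PiM UNIV (\<lambda>_::nat. Pstar) = distr M (PiM UNIV (\<lambda>_::nat. borel)) (\<lambda>\<omega> i. Z i \<omega>)"
      by (simp add: Z_law restrict_UNIV)
    from C[unfolded this]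
    have "AE \<omega> in M. \<forall>\<^sub>F n in sequentially. \<forall>\<theta>\<in>Theta Kb.
           \<bar>\<Sum>i<n. ?f \<theta> (Z i \<omega>) - (\<integral>z. ?f \<theta> z \<partial>Pstar)\<bar> \<le> C * sqrt (real n * ln (ln (real n)))"
      by (rule AE_distrD[rotated]) (intro measurable_PiM_single' Z_meas, auto)
    then show ?thesis
      by (intro exI[of _ C]) (simp add: sum_subtractf s_def ef_def)
  qed
  \<comment> \<open>No larger model has positive drift, so it gains at most 2 C s(n) over
    \<open>\<theta>s\<close>. The penalty gap is at least a fixed fraction of
    \<open>pen n Kstar\<close>, which eventually exceeds this.\<close>
  have over: "AE \<omega> in M. \<forall>\<^sub>F n in sequentially. cr n K \<omega> \<le> cr n Kstar \<omega>"
    if Kb: "Kstar < K" "K \<le> Kb" and D: "donsker Pstar (Ga p pstar Theta Kb)" for K Kb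
  proof -
    from lil[OF _ D] Kb obtain C where "AE \<omega> in M. \<forall>\<^sub>F n in sequentially. \<forall>\<theta>\<in>Theta Kb.
      \<bar>(\<Sum>i<n. ln (p \<theta> (Z i \<omega>))) - (\<Sum>i<n. ln (pstar (Z i \<omega>))) - real n * ef \<theta>\<bar> \<le> C * s n" by auto
    then show ?thesis
    proof eventually_elim
      case (elim \<omega>)
      obtain \<delta> where \<delta>: "1 < \<delta>" "ereal \<delta> < liminf (\<lambda>n. ereal (pen n (Suc Kstar) / pen n Kstar))"
        using ereal_dense2[OF pen_ratio[OF Kstar(1)]] by (auto simp: one_ereal_def)
      have "\<forall>\<^sub>F n in sequentially. ereal \<delta> < ereal (pen n (Suc Kstar) / pen n Kstar)"
        using \<delta>(2) by (rule less_LiminfD)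
      moreover have "\<forall>\<^sub>F n in sequentially. (2 * C) * s n \<le> (\<delta> - 1) * pen n Kstar"
        using \<delta>(1) by (intro s_pen Kstar) auto
      ultimately show ?case using elim
      proof eventually_elim
        case (elim n)
        let ?B = "\<Sum>i<n. ln (pstar (Z i \<omega>))"
        have "\<delta> * pen n Kstar \<le> pen n (Suc Kstar)"
          using elim(1) A4_pos[OF Kstar(1), of n] by (simp add: field_simps)
        also have "\<dots> \<le> pen n K" using Kb by (intro pen_mono) auto
        finally have pen: "\<delta> * pen n Kstar \<le> pen n K" .
        have "cr n K \<omega> \<le> ereal ((?B + C * s n) - pen n K)"
          unfolding cr_def
        proof (rule crit_upper)
          fix \<theta> assume "\<theta> \<in> Theta K"
          moreover have "\<theta> \<in> Theta Kb" using \<open>\<theta> \<in> Theta K\<close> Theta_mono[of K Kb] Kb Kstar(1) by auto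
          ultimately have "real n * ef \<theta> \<le> 0" "\<bar>(\<Sum>i<n. ln (p \<theta> (Z i \<omega>))) - ?B - real n * ef \<theta>\<bar> \<le> C * s n"
            using ef_le_0[of K \<theta>] Kb Kstar(1) elim(3) by (auto simp: mult_nonneg_nonpos)
          then show "(\<Sum>i<n. ln (p \<theta> (Z i \<omega>))) \<le> ?B + C * s n" by linarith
        qed
        also have "\<dots> \<le> ereal ((\<Sum>i<n. ln (p \<theta>s (Z i \<omega>))) - pen n Kstar)"
        proof -
          have "\<theta>s \<in> Theta Kb" using \<theta>s Theta_mono[of Kstar Kb] Kb Kstar(1) by auto
          with elim(3) ef_s have "\<bar>(\<Sum>i<n. ln (p \<theta>s (Z i \<omega>))) - ?B\<bar> \<le> C * s n" by force
          moreover have "2 * (C * s n) \<le> \<delta> * pen n Kstar - pen n Kstar"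
            using elim(2) by (simp add: algebra_simps)
          ultimately show ?thesis using pen by simp
        qed
        also have "\<dots> \<le> cr n Kstar \<omega>" unfolding cr_def by (rule crit_lower[where Theta=Theta, OF \<theta>s(1)])
        finally show ?case .
      qed
    qed
  qed
  \<comment> \<open>A drift advantage of 2 delta per observation pays for both the fluctuations and
    the penalty of \<open>K'\<close>: eventually 2 C s(n) <= \<open>pen n K'\<close> <= delta n.
    Strictness comes from the positive penalty of \<open>K\<close>.\<close>
  have under: "AE \<omega> in M. \<forall>\<^sub>F n in sequentially. cr n K \<omega> < cr n K' \<omega>"
    if K: "1 \<le> K" "K \<le> Kb" "1 \<le> K'" "K' \<le> Kb" "Kstar \<le> Kb" and D: "donsker Pstar (Ga p pstar Theta Kb)"
      and m: "\<And>\<theta>. \<theta> \<in> Theta K \<Longrightarrow> ef \<theta> \<le> m" and \<theta>': "\<theta>' \<in> Theta K'" "m < ef \<theta>'" for K K' Kb m \<theta>'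
  proof -
    from lil[OF K(5) D] obtain C where "AE \<omega> in M. \<forall>\<^sub>F n in sequentially. \<forall>\<theta>\<in>Theta Kb.
      \<bar>(\<Sum>i<n. ln (p \<theta> (Z i \<omega>))) - (\<Sum>i<n. ln (pstar (Z i \<omega>))) - real n * ef \<theta>\<bar> \<le> C * s n" by auto
    then show ?thesis
    proof eventually_elim
      case (elim \<omega>)
      define \<delta> where "\<delta> = (ef \<theta>' - m) / 2"
      have \<delta>: "0 < \<delta>" using \<theta>' by (simp add: \<delta>_def)
      have "\<forall>\<^sub>F n in sequentially. (2 * C) * s n \<le> 1 * pen n K'" by (intro s_pen K) auto
      moreover have "\<forall>\<^sub>F n in sequentially. pen n K' \<le> \<delta> * real n" by (intro pen_n K \<delta>)
      ultimately show ?case using elim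
      proof eventually_elim
        case (elim n)
        let ?B = "\<Sum>i<n. ln (pstar (Z i \<omega>))"
        have "cr n K \<omega> \<le> ereal ((?B + real n * m + C * s n) - pen n K)"
          unfolding cr_def
        proof (rule crit_upper)
          fix \<theta> assume \<theta>: "\<theta> \<in> Theta K"
          moreover have "\<theta> \<in> Theta Kb" using \<theta> Theta_mono[of K Kb] K by auto
          ultimately have "real n * ef \<theta> \<le> real n * m" "\<bar>(\<Sum>i<n. ln (p \<theta> (Z i \<omega>))) - ?B - real n * ef \<theta>\<bar> \<le> C * s n"
            using m[of \<theta>] elim(3) by (auto intro: mult_left_mono)
          then show "(\<Sum>i<n. ln (p \<theta> (Z i \<omega>))) \<le> ?B + real n * m + C * s n" by linarith
        qed
        also have "\<dots> < ereal ((\<Sum>i<n. ln (p \<theta>' (Z i \<omega>))) - pen n K')"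
        proof -
          have "\<theta>' \<in> Theta Kb" using \<theta>' Theta_mono[of K' Kb] K by auto
          with elim(3) have "\<bar>(\<Sum>i<n. ln (p \<theta>' (Z i \<omega>))) - ?B - real n * ef \<theta>'\<bar> \<le> C * s n" by blast
          moreover have "2 * (\<delta> * real n) = real n * ef \<theta>' - real n * m" by (simp add: \<delta>_def field_simps)
          moreover have "2 * (C * s n) \<le> pen n K'" using elim(1) by simp
          ultimately show ?thesis using elim(2) A4_pos[OF K(1), of n] by simp
        qed
        also have "\<dots> \<le> cr n K' \<omega>" unfolding cr_def by (rule crit_lower[where Theta=Theta, OF \<theta>'(1)])
        finally show ?case .
      qed
    qed
  qed
  show ?thesis
  proof (intro conjI impI allI)
    assume hyp: "(\<forall>K\<ge>1. Pstar \<notin> models mu p Theta K \<longrightarrow>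
             KLset Pstar (models mu p Theta (Suc K)) < KLset Pstar (models mu p Theta K))
          \<and> donsker Pstar (Ga p pstar Theta (Suc Kstar))"
    have step: "AE \<omega> in M. \<forall>\<^sub>F n in sequentially. cr n K \<omega> < cr n (Suc K) \<omega>" if K: "K \<in> {1..<Kstar}" for K
    proof -
      have K1: "1 \<le> K" "K < Kstar" using K by auto
      have "Pstar \<notin> models mu p Theta K"
        using not_model[OF K1] K1 by (auto simp: models_def)
      then have "KLset Pstar (models mu p Theta (Suc K)) < KLset Pstar (models mu p Theta K)"
        using hyp K1 by blast
      then obtain Q where "Q \<in> models mu p Theta (Suc K)" and lt: "KL Pstar Q < KLset Pstar (models mu p Theta K)"
        unfolding KLset_def[of Pstar "models mu p Theta (Suc K)"] by (auto simp: INF_less_iff)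
      then obtain \<theta>' where \<theta>': "\<theta>' \<in> Theta (Suc K)" "Q = density mu (p \<theta>')"
        by (auto simp: models_def)
      have "ereal (- ef \<theta>') < KLset Pstar (models mu p Theta K)"
        using lt KL_ef[of "Suc K" \<theta>'] \<theta>' by simp
      \<comment> \<open>A level strictly between the divergence of \<open>\<theta>'\<close> and the
        infimum over the smaller model gives the drift gap for \<open>under\<close>.\<close>
      then obtain w where w: "ereal (- ef \<theta>') < ereal w" "ereal w < KLset Pstar (models mu p Theta K)"
        using ereal_dense2 by blast
      have "ef \<theta> \<le> - w" if "\<theta> \<in> Theta K" for \<theta>
      proof -
        have "KLset Pstar (models mu p Theta K) \<le> KL Pstar (density mu (p \<theta>))"
          unfolding KLset_def using that K1 by (intro INF_lower) (auto simp: models_def)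
        then have "ereal w < ereal (- ef \<theta>)"
          using w(2) unfolding KL_ef[OF K1(1) that] by (rule order.strict_trans2[rotated])
        then show ?thesis by simp
      qed
      then show ?thesis
        using w(1) K1 hyp by (intro under[of K "Suc Kstar" "Suc K" "- w" \<theta>'] \<theta>') auto
    qed
    have "AE \<omega> in M. \<forall>K\<in>{1..<Kstar}. \<forall>\<^sub>F n in sequentially. cr n K \<omega> < cr n (Suc K) \<omega>"
      using step by (intro AE_finite_allI) auto
    moreover have "AE \<omega> in M. \<forall>\<^sub>F n in sequentially. cr n (Suc Kstar) \<omega> \<le> cr n Kstar \<omega>"
      using hyp by (intro over[of "Suc Kstar" "Suc Kstar"]) auto
    ultimately show "AE \<omega> in M. \<forall>\<^sub>F n in sequentially. KhatL p Theta pen Z n \<omega> = enat Kstar"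
    proof eventually_elim
      case (elim \<omega>)
      then have "\<forall>\<^sub>F n in sequentially. \<forall>K\<in>{1..<Kstar}. cr n K \<omega> < cr n (Suc K) \<omega>"
        by (intro eventually_ball_finite) auto
      then show ?case using elim(2)
        by eventually_elim (auto intro!: KhatL_eqI Kstar simp: cr_def)
    qed
  next
    fix Kmax assume hyp: "Kstar \<le> Kmax \<and> donsker Pstar (Ga p pstar Theta Kmax)"
    have step: "AE \<omega> in M. \<forall>\<^sub>F n in sequentially. cr n K \<omega> < cr n Kstar \<omega>" if K: "K \<in> {1..<Kstar}" for K
    proof -
      have K1: "1 \<le> K" "K < Kstar" using K by auto
      \<comment> \<open>Each parameter of a model below the true order has negative drift;
        compactness and continuity make the bound uniform. For an empty model any negative number
        serves.\<close>
      have "\<exists>m<0. \<forall>\<theta>\<in>Theta K. ef \<theta> \<le> m"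
      proof (cases "Theta K = {}")
        case False
        from continuous_attains_sup[OF A1_Theta[OF K1(1)] False ef_cont[OF K1(1)]]
        obtain \<theta>0 where "\<theta>0 \<in> Theta K" "\<forall>\<theta>\<in>Theta K. ef \<theta> \<le> ef \<theta>0" by auto
        moreover have "ef \<theta>0 < 0" using ef_neg[OF K1(1) \<open>\<theta>0 \<in> Theta K\<close> not_model[OF K1 \<open>\<theta>0 \<in> Theta K\<close>]] .
        ultimately show ?thesis by blast
      qed (auto intro: exI[of _ "-1"])
      then obtain m where "m < 0" "\<And>\<theta>. \<theta> \<in> Theta K \<Longrightarrow> ef \<theta> \<le> m" by blast
      then show ?thesis
        using K1 hyp Kstar(1) \<theta>s ef_s by (intro under[of K Kmax Kstar m \<theta>s]) auto
    qed
    have "AE \<omega> in M. \<forall>K\<in>{1..<Kstar}. \<forall>\<^sub>F n in sequentially. cr n K \<omega> < cr n Kstar \<omega>"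
      using step by (intro AE_finite_allI) auto
    moreover have "AE \<omega> in M. \<forall>K\<in>{Kstar<..Kmax}. \<forall>\<^sub>F n in sequentially. cr n K \<omega> \<le> cr n Kstar \<omega>"
      using hyp by (intro AE_finite_allI over[of _ Kmax]) auto
    ultimately show "AE \<omega> in M. \<forall>\<^sub>F n in sequentially. KhatG p Theta pen Z Kmax n \<omega> = Kstar"
    proof eventually_elim
      case (elim \<omega>)
      have "\<forall>\<^sub>F n in sequentially. \<forall>K\<in>{1..<Kstar}. cr n K \<omega> < cr n Kstar \<omega>"
        using elim(1) by (intro eventually_ball_finite) auto
      moreover have "\<forall>\<^sub>F n in sequentially. \<forall>K\<in>{Kstar<..Kmax}. cr n K \<omega> \<le> cr n Kstar \<omega>"
        using elim(2) by (intro eventually_ball_finite) auto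
      ultimately show ?case
        by eventually_elim (use hyp in \<open>auto intro!: KhatG_eqI Kstar simp: cr_def\<close>)
    qed
  qed
qed

end
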